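(* The coherence problem for skew monoidal closed categories is effectively solvable: there is a computable function $\mathsf{focus}$ sending each derivation of a sequent $S \mid \Gamma \vdash A$ in the unfocused sequent calculus for $\mathtt{SkNMILL}$ to a derivation of $S \mid \Gamma \vdash_{\mathsf{RI}} A$ in the focused calculus with tags, such that for all formulae $A, B$ and all derivations $f, g$ of $A \mid \ \vdash B$ one has $$ f \circeq g \iff \mathsf{focus}\, f = \mathsf{focus}\, g, $$ where the equality on the right is syntactic equality of focused derivations, which is decidable. Consequently, it is decidable whether two parallel maps $A \to B$ of the free skew monoidal closed category $\mathsf{FSkMCl}(\mathsf{At})$, given by representing derivations of $A \mid \ \vdash B$, are equal.
   Context: Fix a set $\mathsf{At}$ of atoms. Formulae are generated by $A, B ::= X \mid \mathsf{I} \mid A \otimes B \mid A \multimap B$ with $X \in \mathsf{At}$. A stoup $S$ is either empty (${-}$) or a single formula; a context $\Gamma$ is a finite ordered list of formulae. **Unfocused calculus.** Sequents are triples $S \mid \Gamma \vdash A$. Derivations are inductively generated by (premises $\Longrightarrow$ conclusion): - $\mathsf{ax}_A$: $\Longrightarrow A \mid \ \vdash A$ (any formula $A$); - $\mathsf{pass}$: $A \mid \Gamma \vdash C \Longrightarrow {-} \mid A, \Gamma \vdash C$; - ${\multimap}\mathsf{L}$: ${-} \mid \Gamma \vdash A$ and $B \mid \Delta \vdash C \Longrightarrow A \multimap B \mid \Gamma, \Delta \vdash C$; - ${\multimap}\mathsf{R}$: $S \mid \Gamma, A \vdash B \Longrightarrow S \mid \Gamma \vdash A \multimap B$; - $\mathsf{IL}$: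 ${-} \mid \Gamma \vdash C \Longrightarrow \mathsf{I} \mid \Gamma \vdash C$; - $\otimes\mathsf{L}$: $A \mid B, \Gamma \vdash C \Longrightarrow A \otimes B \mid \Gamma \vdash C$; - $\mathsf{IR}$: $\Longrightarrow {-} \mid \ \vdash \mathsf{I}$; - $\otimes\mathsf{R}$: $S \mid \Gamma \vdash A$ and ${-} \mid \Delta \vdash B \Longrightarrow S \mid \Gamma, \Delta \vdash A \otimes B$. **The congruence $\circeq$** is the smallest family of equivalence relations on derivations of the same sequent that is compatible with all rules and contains (for all well-typed $f,g,h$) $\mathsf{ax}_{\mathsf{I}} \circeq \mathsf{IL}(\mathsf{IR})$; $\mathsf{ax}_{A \otimes B} \circeq \otimes\mathsf{L}(\otimes\mathsf{R}(\mathsf{ax}_A, \mathsf{pass}\,\mathsf{ax}_B))$; $\mathsf{ax}_{A \multimap B} \circeq {\multimap}\mathsf{R}({\multimap}\mathsf{L}(\mathsf{pass}\,\mathsf{ax}_A, \mathsf{ax}_B))$; $\otimes\mathsf{R}(\mathsf{pass} f, g) \circeq \mathsf{pass}(\otimes\mathsf{R}(f,g))$; $\otimes\mathsf{R}(\mathsf{IL} f, g) \circeq \mathsf{IL}(\otimes\mathsf{R}(f,g))$; $\otimes\mathsf{R}(\otimes\mathsf{L} f, g) \circeq \otimes\mathsf{L}(\otimes\mathsf{R}(f,g))$; $\otimes\mathsf{R}({\multimap}\mathsf{L}(f,g), h) \circeq {\multimap}\mathsf{L}(f, \otimes\mathsf{R}(g,h))$; $\mathsf{pass}({\multimap}\mathsf{R}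 f) \circeq {\multimap}\mathsf{R}(\mathsf{pass} f)$; $\mathsf{IL}({\multimap}\mathsf{R} f) \circeq {\multimap}\mathsf{R}(\mathsf{IL} f)$; $\otimes\mathsf{L}({\multimap}\mathsf{R} f) \circeq {\multimap}\mathsf{R}(\otimes\mathsf{L} f)$; ${\multimap}\mathsf{L}(f, {\multimap}\mathsf{R} g) \circeq {\multimap}\mathsf{R}({\multimap}\mathsf{L}(f,g))$. **The category $\mathsf{FSkMCl}(\mathsf{At})$** is the free skew monoidal closed category on $\mathsf{At}$; it has formulae as objects, and its set of maps $A \to B$ is the set of derivations of $A \mid \ \vdash B$ modulo $\circeq$. In particular, equality of the maps represented by derivations $f, g$ of $A \mid \ \vdash B$ means $f \circeq g$. **Focused calculus with tags.** Focused sequents have the form $S \mid \Gamma \vdash^x_{ph} C$ with phase $ph \in \{\mathsf{RI}, \mathsf{LI}, \mathsf{P}, \mathsf{F}\}$ and $x$ either blank (untagged sequent, written $\vdash_{ph}$) or $\bullet$ (tagged sequent). In a tagged sequent each context formula is either untagged ($A$) or tagged ($A^\bullet$), and all untagged formulae precede all tagged ones; in an untagged sequent all context formulae are untagged. For $x$ blank, $A^x$ means $A$. $\Gamma^\circ$ denotes $\Gamma$ with all tags removed. $P$ ranges over positive formulae (formulae not of the form $A \multimap B$); $T$ ranges over negative stoups (stoups that are neither $\mathsf{I}$ nor of the form $A \otimes B$; $T$ may be empty); $X$ ranges over atoms. In $\mathsf{LI}$, $\mathsf{P}$ and $\mathsf{F}$ phases the succedent is always positive, and in $\mathsf{P}$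 and $\mathsf{F}$ phases the stoup is always negative. Rules (with $x$ arbitrary where written): - ${\multimap}\mathsf{R}$: $S \mid \Gamma, A^x \vdash^x_{\mathsf{RI}} B \Longrightarrow S \mid \Gamma \vdash^x_{\mathsf{RI}} A \multimap B$; - $\mathsf{LI2RI}$: $S \mid \Gamma \vdash^x_{\mathsf{LI}} P \Longrightarrow S \mid \Gamma \vdash^x_{\mathsf{RI}} P$; - $\mathsf{IL}$: ${-} \mid \Gamma \vdash_{\mathsf{LI}} P \Longrightarrow \mathsf{I} \mid \Gamma \vdash_{\mathsf{LI}} P$ (untagged only); - $\otimes\mathsf{L}$: $A \mid B, \Gamma \vdash_{\mathsf{LI}} P \Longrightarrow A \otimes B \mid \Gamma \vdash_{\mathsf{LI}} P$ (untagged only); - $\mathsf{P2LI}$: $T \mid \Gamma \vdash^x_{\mathsf{P}} P \Longrightarrow T \mid \Gamma \vdash^x_{\mathsf{LI}} P$; - $\mathsf{pass}$: $A \mid \Gamma^\circ \vdash_{\mathsf{LI}} P \Longrightarrow {-} \mid A^x, \Gamma \vdash^x_{\mathsf{P}} P$; - $\mathsf{F2P}$: $T \mid \Gamma \vdash^x_{\mathsf{F}} P \Longrightarrow T \mid \Gamma \vdash^x_{\mathsf{P}} P$; - $\mathsf{ax}$: $\Longrightarrow X \mid \ \vdash^x_{\mathsf{F}} X$ (atoms only); - $\mathsf{IR}$: $\Longrightarrow {-} \mid \ \vdash^x_{\mathsf{F}} \mathsf{I}$; - $\otimes\mathsf{R}$: $T \mid \Gamma^\circ \vdash^\bullet_{\mathsf{RI}}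 A$ and ${-} \mid \Delta^\circ \vdash_{\mathsf{RI}} B \Longrightarrow T \mid \Gamma, \Delta \vdash^x_{\mathsf{F}} A \otimes B$; - ${\multimap}\mathsf{L}$: ${-} \mid \Gamma^\circ \vdash_{\mathsf{RI}} A$ and $B \mid \Delta^\circ \vdash_{\mathsf{LI}} P \Longrightarrow A \multimap B \mid \Gamma, \Delta \vdash^x_{\mathsf{F}} P$, with the side condition that if $x = \bullet$ then at least one formula in $\Gamma$ is tagged. *)

theory Defs
  imports Main
begin

section \<open>Formulae and the unfocused calculus\<close>

datatype 'a fma =
    Atm 'a
  | Unit  (\<open>\<I>\<close>)
  | Tensor "'a fma" "'a fma"  (infixr \<open>\<otimes>\<close> 75)
  | Lolli "'a fma" "'a fma"  (infixr \<open>\<multimap>\<close> 70)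

type_synonym 'a stoup = "'a fma option"

text \<open>Only axioms carry an annotation: the sequent derived by a term is already determined by
  the sequents of its immediate subterms (lemma \<open>derives_unique\<close>), so that equality of terms is
  equality of derivations.\<close>

datatype 'a deriv =
    Ax "'a fma"
  | Pass "'a deriv"
  | LolliL "'a deriv" "'a deriv"
  | LolliR "'a deriv"
  | IL "'a deriv"
  | TensL "'a deriv"
  | IR
  | TensR "'a deriv" "'a deriv"

text \<open>\<open>derives S \<Gamma> A f\<close>: the term \<open>f\<close> is a derivation of \<open>S | \<Gamma> \<turnstile> A\<close>.\<close>

inductive derives :: "'a stoup \<Rightarrow> 'a fma list \<Rightarrow> 'a fma \<Rightarrow> 'a deriv \<Rightarrow> bool" where
  ax: "derives (Some A) [] A (Ax A)"
| pass: "derives (Some A) \<Gamma> C f \<Longrightarrow> derives None (A # \<Gamma>) C (Pass f)"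
| lolliL: "derives None \<Gamma> A f \<Longrightarrow> derives (Some B) \<Delta> C g
    \<Longrightarrow> derives (Some (A \<multimap> B)) (\<Gamma> @ \<Delta>) C (LolliL f g)"
| lolliR: "derives S (\<Gamma> @ [A]) B f \<Longrightarrow> derives S \<Gamma> (A \<multimap> B) (LolliR f)"
| il: "derives None \<Gamma> C f \<Longrightarrow> derives (Some \<I>) \<Gamma> C (IL f)"
| tensL: "derives (Some A) (B # \<Gamma>) C f \<Longrightarrow> derives (Some (A \<otimes> B)) \<Gamma> C (TensL f)"
| ir: "derives None [] \<I> IR"
| tensR: "derives S \<Gamma> A f \<Longrightarrow> derives None \<Delta> B g
    \<Longrightarrow> derives S (\<Gamma> @ \<Delta>) (A \<otimes> B) (TensR f g)"

lemma derives_unique: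
  assumes "derives S \<Gamma> A f" "derives S' \<Gamma>' A' f"
  shows "S = S' \<and> \<Gamma> = \<Gamma>' \<and> A = A'"
  using assms
proof (induction arbitrary: S' \<Gamma>' A' rule: derives.induct)
  case (ax A) then show ?case by cases auto
next
  case (pass A \<Gamma> C f) from pass.prems pass.IH show ?case by cases auto
next
  case (lolliL \<Gamma> A f B \<Delta> C g) from lolliL.prems lolliL.IH show ?case by cases (auto, blast+)
next
  case (lolliR S \<Gamma> A B f) from lolliR.prems lolliR.IH show ?case by cases fastforce
next
  case (il \<Gamma> C f) from il.prems il.IH show ?case by cases auto
next
  case (tensL A B \<Gamma> C f) from tensL.prems tensL.IH show ?case by cases fastforce
next
  case ir then show ?case by cases auto
next
  case (tensR S \<Gamma> A f \<Delta> B g) from tensR.prems tensR.IH show ?case by cases blast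
qed


section \<open>The congruence on unfocused derivations\<close>

text \<open>\<open>ceq S \<Gamma> A f g\<close>: the derivations \<open>f\<close> and \<open>g\<close> of \<open>S | \<Gamma> \<turnstile> A\<close> are congruent.\<close>

inductive ceq :: "'a stoup \<Rightarrow> 'a fma list \<Rightarrow> 'a fma \<Rightarrow> 'a deriv \<Rightarrow> 'a deriv \<Rightarrow> bool" where
  refl: "derives S \<Gamma> A f \<Longrightarrow> ceq S \<Gamma> A f f"
| sym: "ceq S \<Gamma> A f g \<Longrightarrow> ceq S \<Gamma> A g f"
| trans: "ceq S \<Gamma> A f g \<Longrightarrow> ceq S \<Gamma> A g h \<Longrightarrow> ceq S \<Gamma> A f h"
| cong_pass: "ceq (Some A) \<Gamma> C f f' \<Longrightarrow> ceq None (A # \<Gamma>) C (Pass f) (Pass f')"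
| cong_lolliL: "ceq None \<Gamma> A f f' \<Longrightarrow> ceq (Some B) \<Delta> C g g'
    \<Longrightarrow> ceq (Some (A \<multimap> B)) (\<Gamma> @ \<Delta>) C (LolliL f g) (LolliL f' g')"
| cong_lolliR: "ceq S (\<Gamma> @ [A]) B f f' \<Longrightarrow> ceq S \<Gamma> (A \<multimap> B) (LolliR f) (LolliR f')"
| cong_il: "ceq None \<Gamma> C f f' \<Longrightarrow> ceq (Some \<I>) \<Gamma> C (IL f) (IL f')"
| cong_tensL: "ceq (Some A) (B # \<Gamma>) C f f'
    \<Longrightarrow> ceq (Some (A \<otimes> B)) \<Gamma> C (TensL f) (TensL f')"
| cong_tensR: "ceq S \<Gamma> A f f' \<Longrightarrow> ceq None \<Delta> B g g'
    \<Longrightarrow> ceq S (\<Gamma> @ \<Delta>) (A \<otimes> B) (TensR f g) (TensR f' g')"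
| ax_I: "ceq (Some \<I>) [] \<I> (Ax \<I>) (IL IR)"
| ax_tens: "ceq (Some (A \<otimes> B)) [] (A \<otimes> B)
    (Ax (A \<otimes> B)) (TensL (TensR (Ax A) (Pass (Ax B))))"
| ax_lolli: "ceq (Some (A \<multimap> B)) [] (A \<multimap> B)
    (Ax (A \<multimap> B)) (LolliR (LolliL (Pass (Ax A)) (Ax B)))"
| tensR_pass: "derives (Some A') \<Gamma> A f \<Longrightarrow> derives None \<Delta> B g
    \<Longrightarrow> ceq None (A' # \<Gamma> @ \<Delta>) (A \<otimes> B) (TensR (Pass f) g) (Pass (TensR f g))"
| tensR_il: "derives None \<Gamma> A f \<Longrightarrow> derives None \<Delta> B g
    \<Longrightarrow> ceq (Some \<I>) (\<Gamma> @ \<Delta>) (A \<otimes> B) (TensR (IL f) g) (IL (TensR f g))"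
| tensR_tensL: "derives (Some A') (B' # \<Gamma>) A f \<Longrightarrow> derives None \<Delta> B g
    \<Longrightarrow> ceq (Some (A' \<otimes> B')) (\<Gamma> @ \<Delta>) (A \<otimes> B) (TensR (TensL f) g) (TensL (TensR f g))"
| tensR_lolliL: "derives None \<Gamma> A' f \<Longrightarrow> derives (Some B') \<Delta> A g \<Longrightarrow> derives None \<Lambda> B h
    \<Longrightarrow> ceq (Some (A' \<multimap> B')) (\<Gamma> @ \<Delta> @ \<Lambda>) (A \<otimes> B)
          (TensR (LolliL f g) h) (LolliL f (TensR g h))"
| pass_lolliR: "derives (Some A') (\<Gamma> @ [A]) B f
    \<Longrightarrow> ceq None (A' # \<Gamma>) (A \<multimap> B) (Pass (LolliR f)) (LolliR (Pass f))"
| il_lolliR: "derives None (\<Gamma> @ [A]) B f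
    \<Longrightarrow> ceq (Some \<I>) \<Gamma> (A \<multimap> B) (IL (LolliR f)) (LolliR (IL f))"
| tensL_lolliR: "derives (Some A') (B' # \<Gamma> @ [A]) B f
    \<Longrightarrow> ceq (Some (A' \<otimes> B')) \<Gamma> (A \<multimap> B) (TensL (LolliR f)) (LolliR (TensL f))"
| lolliL_lolliR: "derives None \<Gamma> A' f \<Longrightarrow> derives (Some B') (\<Delta> @ [A]) B g
    \<Longrightarrow> ceq (Some (A' \<multimap> B')) (\<Gamma> @ \<Delta>) (A \<multimap> B)
          (LolliL f (LolliR g)) (LolliR (LolliL f g))"


section \<open>Hom-sets of the free skew monoidal closed category\<close>

definition FSkMCl_hom :: "'a fma \<Rightarrow> 'a fma \<Rightarrow> 'a deriv set set" where
  "FSkMCl_hom A B = {f. derives (Some A) [] B f} // {(f, g). ceq (Some A) [] B f g}"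


section \<open>The focused calculus with tags\<close>

datatype phase = RI_ph | LI_ph | P_ph | F_ph

datatype tag = Blank | Bullet

text \<open>A context formula \<open>(A, x)\<close> stands for \<open>A\<^sup>x\<close>.\<close>

type_synonym 'a tctx = "('a fma \<times> tag) list"

definition untag :: "'a tctx \<Rightarrow> 'a tctx" where
  "untag \<Gamma> = map (\<lambda>(A, x). (A, Blank)) \<Gamma>"

definition plain :: "'a fma list \<Rightarrow> 'a tctx" where
  "plain \<Gamma> = map (\<lambda>A. (A, Blank)) \<Gamma>"

definition positive :: "'a fma \<Rightarrow> bool" where
  "positive A \<longleftrightarrow> (\<nexists>B C. A = B \<multimap> C)"

definition negative :: "'a stoup \<Rightarrow> bool" where
  "negative S \<longleftrightarrow> S \<noteq> Some \<I> \<and> (\<nexists>A B. S = Some (A \<otimes> B))"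

definition wf_ctx :: "tag \<Rightarrow> 'a tctx \<Rightarrow> bool" where
  "wf_ctx x \<Gamma> \<longleftrightarrow>
     (case x of
        Blank \<Rightarrow> (\<exists>\<Delta>. \<Gamma> = plain \<Delta>)
      | Bullet \<Rightarrow> (\<exists>\<Delta> \<Lambda>. \<Gamma> = plain \<Delta> @ map (\<lambda>A. (A, Bullet)) \<Lambda>))"

definition wf_seq :: "phase \<Rightarrow> tag \<Rightarrow> 'a stoup \<Rightarrow> 'a tctx \<Rightarrow> 'a fma \<Rightarrow> bool" where
  "wf_seq ph x S \<Gamma> C \<longleftrightarrow>
     wf_ctx x \<Gamma> \<and> (ph \<in> {LI_ph, P_ph, F_ph} \<longrightarrow> positive C) \<and> (ph \<in> {P_ph, F_ph} \<longrightarrow> negative S)"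

text \<open>A term together with the sequent it derives determines the whole derivation tree: stoup,
  succedent and untagged context of a sequent can be read off the term (lemma
  \<open>fderives_unique\<close>), and so can the splitting of the context in the two-premise rules, while the
  tags in the premises are determined by the rule and the conclusion. Hence, for derivations of
  the same sequent, equality of terms is syntactic equality of derivations.\<close>

datatype 'a fderiv =
    FLolliR "'a fderiv"
  | LI2RI "'a fderiv"
  | FIL "'a fderiv"
  | FTensL "'a fderiv"
  | P2LI "'a fderiv"
  | FPass "'a fderiv"
  | F2P "'a fderiv"
  | FAx 'a
  | FIR
  | FTensR "'a fderiv" "'a fderiv"
  | FLolliL "'a fderiv" "'a fderiv"

text \<open>\<open>fderives ph x S \<Gamma> C f\<close>: the term \<open>f\<close> is a derivation of the focused sequent with phase
  \<open>ph\<close>, tag \<open>x\<close>, stoup \<open>S\<close>, context \<open>\<Gamma>\<close> and succedent \<open>C\<close>. Every rule demands that its conclusion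
  is a well-formed sequent; its premises then are well-formed because they are derivable.\<close>

inductive fderives ::
  "phase \<Rightarrow> tag \<Rightarrow> 'a stoup \<Rightarrow> 'a tctx \<Rightarrow> 'a fma \<Rightarrow> 'a fderiv \<Rightarrow> bool" where
  f_lolliR: "fderives RI_ph x S (\<Gamma> @ [(A, x)]) B f \<Longrightarrow> wf_seq RI_ph x S \<Gamma> (A \<multimap> B)
    \<Longrightarrow> fderives RI_ph x S \<Gamma> (A \<multimap> B) (FLolliR f)"
| f_li2ri: "fderives LI_ph x S \<Gamma> C f \<Longrightarrow> wf_seq RI_ph x S \<Gamma> C \<Longrightarrow> positive C
    \<Longrightarrow> fderives RI_ph x S \<Gamma> C (LI2RI f)"
| f_il: "fderives LI_ph Blank None \<Gamma> C f \<Longrightarrow> wf_seq LI_ph Blank (Some \<I>) \<Gamma> C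
    \<Longrightarrow> fderives LI_ph Blank (Some \<I>) \<Gamma> C (FIL f)"
| f_tensL: "fderives LI_ph Blank (Some A) ((B, Blank) # \<Gamma>) C f
    \<Longrightarrow> wf_seq LI_ph Blank (Some (A \<otimes> B)) \<Gamma> C
    \<Longrightarrow> fderives LI_ph Blank (Some (A \<otimes> B)) \<Gamma> C (FTensL f)"
| f_p2li: "fderives P_ph x S \<Gamma> C f \<Longrightarrow> wf_seq LI_ph x S \<Gamma> C \<Longrightarrow> negative S
    \<Longrightarrow> fderives LI_ph x S \<Gamma> C (P2LI f)"
| f_pass: "fderives LI_ph Blank (Some A) (untag \<Gamma>) C f \<Longrightarrow> wf_seq P_ph x None ((A, x) # \<Gamma>) C
    \<Longrightarrow> fderives P_ph x None ((A, x) # \<Gamma>) C (FPass f)"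
| f_f2p: "fderives F_ph x S \<Gamma> C f \<Longrightarrow> wf_seq P_ph x S \<Gamma> C
    \<Longrightarrow> fderives P_ph x S \<Gamma> C (F2P f)"
| f_ax: "fderives F_ph x (Some (Atm X)) [] (Atm X) (FAx X)"
| f_ir: "fderives F_ph x None [] \<I> FIR"
| f_tensR: "fderives RI_ph Bullet S (untag \<Gamma>) A f \<Longrightarrow> fderives RI_ph Blank None (untag \<Delta>) B g
    \<Longrightarrow> wf_seq F_ph x S (\<Gamma> @ \<Delta>) (A \<otimes> B)
    \<Longrightarrow> fderives F_ph x S (\<Gamma> @ \<Delta>) (A \<otimes> B) (FTensR f g)"
| f_lolliL: "fderives RI_ph Blank None (untag \<Gamma>) A f \<Longrightarrow> fderives LI_ph Blank (Some B) (untag \<Delta>) C g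
    \<Longrightarrow> (x = Bullet \<longrightarrow> (\<exists>D. (D, Bullet) \<in> set \<Gamma>))
    \<Longrightarrow> wf_seq F_ph x (Some (A \<multimap> B)) (\<Gamma> @ \<Delta>) C
    \<Longrightarrow> fderives F_ph x (Some (A \<multimap> B)) (\<Gamma> @ \<Delta>) C (FLolliL f g)"

lemma fderives_wf: "fderives ph x S \<Gamma> C f \<Longrightarrow> wf_seq ph x S \<Gamma> C"
proof (induction rule: fderives.induct)
  case (f_ax x X)
  show ?case by (cases x) (simp_all add: wf_seq_def wf_ctx_def plain_def positive_def negative_def)
next
  case (f_ir x)
  show ?case by (cases x) (simp_all add: wf_seq_def wf_ctx_def plain_def positive_def negative_def)
qed

lemma map_fst_untag [simp]: "map fst (untag \<Gamma>) = map fst \<Gamma>"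
  by (induction \<Gamma>) (auto simp: untag_def)

lemma fderives_unique:
  assumes "fderives ph x S \<Gamma> C f" "fderives ph' x' S' \<Gamma>' C' f"
  shows "ph = ph' \<and> S = S' \<and> map fst \<Gamma> = map fst \<Gamma>' \<and> C = C'"
  using assms
proof (induction arbitrary: ph' x' S' \<Gamma>' C' rule: fderives.induct)
  case f_lolliR from f_lolliR.prems f_lolliR.IH show ?case by cases fastforce
next
  case f_li2ri from f_li2ri.prems f_li2ri.IH show ?case by cases fastforce
next
  case f_il from f_il.prems f_il.IH show ?case by cases fastforce
next
  case f_tensL from f_tensL.prems f_tensL.IH show ?case by cases fastforce
next
  case f_p2li from f_p2li.prems f_p2li.IH show ?case by cases fastforce
next
  case f_pass from f_pass.prems f_pass.IH show ?case by cases fastforce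
next
  case f_f2p from f_f2p.prems f_f2p.IH show ?case by cases fastforce
next
  case f_ax then show ?case by cases auto
next
  case f_ir then show ?case by cases auto
next
  case f_tensR from f_tensR.prems f_tensR.IH show ?case by cases fastforce
next
  case f_lolliL from f_lolliL.prems f_lolliL.IH show ?case by cases fastforce
qed


section \<open>Computability\<close>

text \<open>Computability is understood as in McCarthy's first-order LISP: inputs and outputs are
  S-expressions, and a function is computable if a finite system of recursion equations over
  the primitives quote-nil, cons, car, cdr, atom, eq and conditional evaluates it. The elements of
  the set of atoms occur in S-expressions as opaque atomic symbols, which programs can only copy
  and compare for equality by eq; no enumeration of the set of atoms is needed.\<close>

datatype 'a sexp = SNil | Sym 'a | SCons "'a sexp" "'a sexp"

datatype expr =
    Var nat
  | NilE
  | ConsE expr expr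
  | CarE expr
  | CdrE expr
  | AtomE expr
  | EqE expr expr
  | IfE expr expr expr
  | Call nat "expr list"

fun atomic :: "'a sexp \<Rightarrow> bool" where
  "atomic (SCons _ _) = False"
| "atomic _ = True"

fun enc_bool :: "bool \<Rightarrow> 'a sexp" where
  "enc_bool False = SNil"
| "enc_bool True = SCons SNil SNil"

text \<open>A program is the list of the bodies of its functions; \<open>Call i\<close> invokes the \<open>i\<close>-th one.
  In a body, \<open>Var n\<close> is the \<open>n\<close>-th argument. As in LISP, eq compares atomic S-expressions only,
  and every value other than \<open>SNil\<close> counts as true. Evaluation is call-by-value; it is undefined
  where it gets stuck or does not terminate.\<close>

inductive
  eval :: "expr list \<Rightarrow> 'a sexp list \<Rightarrow> expr \<Rightarrow> 'a sexp \<Rightarrow> bool" and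
  evals :: "expr list \<Rightarrow> 'a sexp list \<Rightarrow> expr list \<Rightarrow> 'a sexp list \<Rightarrow> bool"
  for p :: "expr list" where
  e_var: "n < length \<rho> \<Longrightarrow> eval p \<rho> (Var n) (\<rho> ! n)"
| e_nil: "eval p \<rho> NilE SNil"
| e_cons: "eval p \<rho> a u \<Longrightarrow> eval p \<rho> b v \<Longrightarrow> eval p \<rho> (ConsE a b) (SCons u v)"
| e_car: "eval p \<rho> a (SCons u v) \<Longrightarrow> eval p \<rho> (CarE a) u"
| e_cdr: "eval p \<rho> a (SCons u v) \<Longrightarrow> eval p \<rho> (CdrE a) v"
| e_atom: "eval p \<rho> a u \<Longrightarrow> eval p \<rho> (AtomE a) (enc_bool (atomic u))"
| e_eq: "eval p \<rho> a u \<Longrightarrow> eval p \<rho> b v \<Longrightarrow> atomic u \<Longrightarrow> atomic v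
    \<Longrightarrow> eval p \<rho> (EqE a b) (enc_bool (u = v))"
| e_if_true: "eval p \<rho> c w \<Longrightarrow> w \<noteq> SNil \<Longrightarrow> eval p \<rho> a u \<Longrightarrow> eval p \<rho> (IfE c a b) u"
| e_if_false: "eval p \<rho> c SNil \<Longrightarrow> eval p \<rho> b v \<Longrightarrow> eval p \<rho> (IfE c a b) v"
| e_call: "i < length p \<Longrightarrow> evals p \<rho> as us \<Longrightarrow> eval p us (p ! i) v
    \<Longrightarrow> eval p \<rho> (Call i as) v"
| es_nil: "evals p \<rho> [] []"
| es_cons: "eval p \<rho> a u \<Longrightarrow> evals p \<rho> as us \<Longrightarrow> evals p \<rho> (a # as) (u # us)"

lemma eval_deterministic:
  "eval p \<rho> e u \<Longrightarrow> eval p \<rho> e u' \<Longrightarrow> u = u'"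
  "evals p \<rho> es us \<Longrightarrow> evals p \<rho> es us' \<Longrightarrow> us = us'"
proof (induction arbitrary: u' and us' rule: eval_evals.inducts)
  case e_var then show ?case by (auto elim: eval.cases)
next
  case e_nil then show ?case by (auto elim: eval.cases)
next
  case e_cons from e_cons.prems e_cons.IH show ?case by cases blast
next
  case e_car from e_car.prems e_car.IH show ?case by cases blast
next
  case e_cdr from e_cdr.prems e_cdr.IH show ?case by cases blast
next
  case e_atom from e_atom.prems e_atom.IH show ?case by cases blast
next
  case e_eq from e_eq.prems e_eq.IH show ?case by cases blast
next
  case e_if_true from e_if_true.prems e_if_true.IH e_if_true.hyps show ?case by cases blast+
next
  case e_if_false from e_if_false.prems e_if_false.IH show ?case by cases blast+
next
  case e_call from e_call.prems e_call.IH show ?case by cases blast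
next
  case es_nil then show ?case by (auto elim: evals.cases)
next
  case es_cons from es_cons.prems es_cons.IH show ?case by cases blast
qed

text \<open>\<open>computable_on enc enc' D \<phi>\<close>: some program, started with main expression \<open>e\<close> on the code of
  an argument in \<open>D\<close>, terminates with the code of the value of \<open>\<phi>\<close>.\<close>

definition computable_on ::
  "('b \<Rightarrow> 'a sexp) \<Rightarrow> ('c \<Rightarrow> 'a sexp) \<Rightarrow> 'b set \<Rightarrow> ('b \<Rightarrow> 'c) \<Rightarrow> bool" where
  "computable_on enc enc' D \<phi> \<longleftrightarrow> (\<exists>p e. \<forall>x \<in> D. eval p [enc x] e (enc' (\<phi> x)))"

definition decidable_on :: "('b \<Rightarrow> 'a sexp) \<Rightarrow> 'b set \<Rightarrow> ('b \<Rightarrow> bool) \<Rightarrow> bool" where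
  "decidable_on enc D Q \<longleftrightarrow> computable_on enc enc_bool D Q"


subsection \<open>Syntax as S-expressions\<close>

text \<open>A constructor is coded by its position in the datatype declaration (as a unary numeral),
  followed by the list of the codes of its arguments.\<close>

fun num :: "nat \<Rightarrow> 'a sexp" where
  "num 0 = SNil"
| "num (Suc n) = SCons SNil (num n)"

definition node :: "nat \<Rightarrow> 'a sexp list \<Rightarrow> 'a sexp" where
  "node k us = SCons (num k) (foldr SCons us SNil)"

primrec enc_fma :: "'a fma \<Rightarrow> 'a sexp" where
  "enc_fma (Atm X) = node 0 [Sym X]"
| "enc_fma \<I> = node 1 []"
| "enc_fma (A \<otimes> B) = node 2 [enc_fma A, enc_fma B]"
| "enc_fma (A \<multimap> B) = node 3 [enc_fma A, enc_fma B]"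

primrec enc_deriv :: "'a deriv \<Rightarrow> 'a sexp" where
  "enc_deriv (Ax A) = node 0 [enc_fma A]"
| "enc_deriv (Pass f) = node 1 [enc_deriv f]"
| "enc_deriv (LolliL f g) = node 2 [enc_deriv f, enc_deriv g]"
| "enc_deriv (LolliR f) = node 3 [enc_deriv f]"
| "enc_deriv (IL f) = node 4 [enc_deriv f]"
| "enc_deriv (TensL f) = node 5 [enc_deriv f]"
| "enc_deriv IR = node 6 []"
| "enc_deriv (TensR f g) = node 7 [enc_deriv f, enc_deriv g]"

primrec enc_fderiv :: "'a fderiv \<Rightarrow> 'a sexp" where
  "enc_fderiv (FLolliR f) = node 0 [enc_fderiv f]"
| "enc_fderiv (LI2RI f) = node 1 [enc_fderiv f]"
| "enc_fderiv (FIL f) = node 2 [enc_fderiv f]"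
| "enc_fderiv (FTensL f) = node 3 [enc_fderiv f]"
| "enc_fderiv (P2LI f) = node 4 [enc_fderiv f]"
| "enc_fderiv (FPass f) = node 5 [enc_fderiv f]"
| "enc_fderiv (F2P f) = node 6 [enc_fderiv f]"
| "enc_fderiv (FAx X) = node 7 [Sym X]"
| "enc_fderiv FIR = node 8 []"
| "enc_fderiv (FTensR f g) = node 9 [enc_fderiv f, enc_fderiv g]"
| "enc_fderiv (FLolliL f g) = node 10 [enc_fderiv f, enc_fderiv g]"

definition enc_pair :: "('b \<Rightarrow> 'a sexp) \<Rightarrow> ('c \<Rightarrow> 'a sexp) \<Rightarrow> 'b \<times> 'c \<Rightarrow> 'a sexp" where
  "enc_pair enc enc' = (\<lambda>(x, y). SCons (enc x) (enc' y))"

text \<open>The input of the decision problem for maps \<open>A \<rightarrow> B\<close> represented by derivations \<open>f\<close> and \<open>g\<close>.\<close>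

definition enc_problem :: "('a fma \<times> 'a fma) \<times> ('a deriv \<times> 'a deriv) \<Rightarrow> 'a sexp" where
  "enc_problem = enc_pair (enc_pair enc_fma enc_fma) (enc_pair enc_deriv enc_deriv)"

end

(* Focused terms carry no tags, and the sequent of a term is determined by the term; hence focusing
   can be defined as a structurally recursive function on terms, in which every unfocused rule is an
   admissible rule of the RI phase. Left rules are pushed above the final right implications. The rule
   for a tensor on the right is permuted upwards past all left rules that do not use a formula
   discharged by those implications: exactly the derivations at which it gets stuck remain derivable
   when the discharged formulae are tagged. Each admissible rule simulates the unfocused one up to
   congruence, so a derivation is congruent to its focused form, and all generating equations of the
   congruence become identities between focused terms. *)

theory Submission
  imports Defs
begin

section \<open>Focusing\<close>

primrec emb :: "'a fderiv \<Rightarrow> 'a deriv" where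
  "emb (FLolliR f) = LolliR (emb f)"
| "emb (LI2RI f) = emb f"
| "emb (FIL f) = IL (emb f)"
| "emb (FTensL f) = TensL (emb f)"
| "emb (P2LI f) = emb f"
| "emb (FPass f) = Pass (emb f)"
| "emb (F2P f) = emb f"
| "emb (FAx X) = Ax (Atm X)"
| "emb FIR = IR"
| "emb (FTensR f g) = TensR (emb f) (emb g)"
| "emb (FLolliL f g) = LolliL (emb f) (emb g)"

text \<open>The subtractions do not truncate on derivations.\<close>

primrec ctx_len :: "'a fderiv \<Rightarrow> nat" where
  "ctx_len (FLolliR f) = ctx_len f - 1"
| "ctx_len (LI2RI f) = ctx_len f"
| "ctx_len (FIL f) = ctx_len f"
| "ctx_len (FTensL f) = ctx_len f - 1"
| "ctx_len (P2LI f) = ctx_len f"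
| "ctx_len (FPass f) = Suc (ctx_len f)"
| "ctx_len (F2P f) = ctx_len f"
| "ctx_len (FAx X) = 0"
| "ctx_len FIR = 0"
| "ctx_len (FTensR f g) = ctx_len f + ctx_len g"
| "ctx_len (FLolliL f g) = ctx_len f + ctx_len g"

text \<open>In \<open>under\<close>, \<open>movable\<close> and \<open>push\<close> the clauses for terms of the wrong phase are junk.\<close>

primrec under :: "('a fderiv \<Rightarrow> 'a fderiv) \<Rightarrow> 'a fderiv \<Rightarrow> 'a fderiv" where
  "under k (FLolliR f) = FLolliR (under k f)"
| "under k (LI2RI f) = LI2RI (k f)"
| "under k (FIL f) = FIL f"
| "under k (FTensL f) = FTensL f"
| "under k (P2LI f) = P2LI f"
| "under k (FPass f) = FPass f"
| "under k (F2P f) = F2P f"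
| "under k (FAx X) = FAx X"
| "under k FIR = FIR"
| "under k (FTensR f g) = FTensR f g"
| "under k (FLolliL f g) = FLolliL f g"

text \<open>If \<open>f\<close> derives \<open>T | \<Gamma>, \<Gamma>' \<turnstile>\<^sub>P P\<close> with \<open>\<Gamma>'\<close> of length \<open>n\<close>, then \<open>movable f n\<close> says that the last
  rule of \<open>f\<close> is a left rule whose principal and left-premise formulae all come from \<open>\<Gamma>\<close>. Such
  a rule commutes with a \<open>\<otimes>R\<close> below that discharges \<open>\<Gamma>'\<close> by \<open>\<multimap>R\<close> first; all other derivations
  remain derivable when \<open>\<Gamma>'\<close> is tagged.\<close>

primrec movable :: "'a fderiv \<Rightarrow> nat \<Rightarrow> bool" where
  "movable (FLolliR f) n = False"
| "movable (LI2RI f) n = False"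
| "movable (FIL f) n = False"
| "movable (FTensL f) n = False"
| "movable (P2LI f) n = False"
| "movable (FPass f) n = (n \<le> ctx_len f)"
| "movable (F2P f) n = movable f n"
| "movable (FAx X) n = False"
| "movable FIR n = False"
| "movable (FTensR f g) n = False"
| "movable (FLolliL f g) n = (n \<le> ctx_len g)"

primrec lolliRs :: "nat \<Rightarrow> 'a fderiv \<Rightarrow> 'a fderiv" where
  "lolliRs 0 f = f"
| "lolliRs (Suc n) f = FLolliR (lolliRs n f)"

text \<open>\<open>push f n g\<close> is \<open>\<otimes>R(\<multimap>R\<^sup>n f, g)\<close> with \<open>\<otimes>R\<close> permuted above all left rules of \<open>f\<close> that do not
  depend on the \<open>n\<close> discharged formulae.\<close>

primrec push :: "'a fderiv \<Rightarrow> nat \<Rightarrow> 'a fderiv \<Rightarrow> 'a fderiv" where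
  "push (FLolliR f) n g = push f (Suc n) g"
| "push (LI2RI f) n g = LI2RI (push f n g)"
| "push (FIL f) n g = FIL (push f n g)"
| "push (FTensL f) n g = FTensL (push f n g)"
| "push (P2LI f) n g =
     (if movable f n then P2LI (push f n g)
      else P2LI (F2P (FTensR (lolliRs n (LI2RI (P2LI f))) g)))"
| "push (FPass f) n g = FPass (push f n g)"
| "push (F2P f) n g = F2P (push f n g)"
| "push (FAx X) n g = FAx X"
| "push FIR n g = FIR"
| "push (FTensR f h) n g = FTensR f h"
| "push (FLolliL f h) n g = FLolliL f (push h n g)"

definition pass_RI :: "'a fderiv \<Rightarrow> 'a fderiv" where
  "pass_RI = under (\<lambda>f. P2LI (FPass f))"

definition il_RI :: "'a fderiv \<Rightarrow> 'a fderiv" where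
  "il_RI = under FIL"

definition tensL_RI :: "'a fderiv \<Rightarrow> 'a fderiv" where
  "tensL_RI = under FTensL"

definition lolliL_RI :: "'a fderiv \<Rightarrow> 'a fderiv \<Rightarrow> 'a fderiv" where
  "lolliL_RI f = under (\<lambda>g. P2LI (F2P (FLolliL f g)))"

definition tensR_RI :: "'a fderiv \<Rightarrow> 'a fderiv \<Rightarrow> 'a fderiv" where
  "tensR_RI f g = push f 0 g"

text \<open>Focused axioms are atomic, so identities are eta-expanded along the right-hand sides of
  the three axiom equations of the congruence, which \<open>focus\<close> thereby turns into
  identities.\<close>

primrec ax_RI :: "'a fma \<Rightarrow> 'a fderiv" where
  "ax_RI (Atm X) = LI2RI (P2LI (F2P (FAx X)))"
| "ax_RI \<I> = il_RI (LI2RI (P2LI (F2P FIR)))"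
| "ax_RI (A \<otimes> B) = tensL_RI (tensR_RI (ax_RI A) (pass_RI (ax_RI B)))"
| "ax_RI (A \<multimap> B) = FLolliR (lolliL_RI (pass_RI (ax_RI A)) (ax_RI B))"

primrec focus :: "'a deriv \<Rightarrow> 'a fderiv" where
  "focus (Ax A) = ax_RI A"
| "focus (Pass f) = pass_RI (focus f)"
| "focus (LolliL f g) = lolliL_RI (focus f) (focus g)"
| "focus (LolliR f) = FLolliR (focus f)"
| "focus (IL f) = il_RI (focus f)"
| "focus (TensL f) = tensL_RI (focus f)"
| "focus IR = LI2RI (P2LI (F2P FIR))"
| "focus (TensR f g) = tensR_RI (focus f) (focus g)"

section \<open>Untagged focused derivations\<close>

lemma untag_eq_plain: "untag \<Gamma> = plain (map fst \<Gamma>)"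
  by (induction \<Gamma>) (auto simp: untag_def plain_def)

lemma length_untag [simp]: "length (untag \<Gamma>) = length \<Gamma>"
  by (simp add: untag_def)

lemma plain_Nil [simp]: "plain [] = []"
  and map_fst_plain [simp]: "map fst (plain \<Gamma>) = \<Gamma>"
  and length_plain [simp]: "length (plain \<Gamma>) = length \<Gamma>"
  by (auto simp: plain_def comp_def)

lemma plain_fold [simp]:
  "(A, Blank) # plain \<Gamma> = plain (A # \<Gamma>)"
  "plain \<Gamma> @ plain \<Delta> = plain (\<Gamma> @ \<Delta>)"
  "plain \<Gamma> @ [(A, Blank)] = plain (\<Gamma> @ [A])"
  by (auto simp: plain_def)

lemma plain_inject [simp]: "plain \<Gamma> = plain \<Delta> \<longleftrightarrow> \<Gamma> = \<Delta>"
  by (metis map_fst_plain)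

lemma plain_eq_append_conv:
  "plain \<Gamma> = \<Gamma>1 @ \<Gamma>2 \<longleftrightarrow> (\<exists>\<Delta>1 \<Delta>2. \<Gamma> = \<Delta>1 @ \<Delta>2 \<and> \<Gamma>1 = plain \<Delta>1 \<and> \<Gamma>2 = plain \<Delta>2)"
  unfolding plain_def map_eq_append_conv by blast

lemma plain_eq_Cons_conv:
  "plain \<Gamma> = (A, x) # \<Delta> \<longleftrightarrow> (\<exists>\<Lambda>. \<Gamma> = A # \<Lambda> \<and> x = Blank \<and> \<Delta> = plain \<Lambda>)"
  by (cases \<Gamma>) (auto simp: plain_def)

lemma wf_ctx_Blank [simp]: "wf_ctx Blank (plain \<Gamma>)"
  by (auto simp: wf_ctx_def)

lemma wf_seq_Blank:
  "wf_seq ph Blank S (plain \<Gamma>) C \<longleftrightarrow>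
     (ph \<in> {LI_ph, P_ph, F_ph} \<longrightarrow> positive C) \<and> (ph \<in> {P_ph, F_ph} \<longrightarrow> negative S)"
  by (simp add: wf_seq_def)

lemma positive_simps [simp]:
  "positive (Atm X)" "positive \<I>" "positive (A \<otimes> B)" "\<not> positive (A \<multimap> B)"
  by (auto simp: positive_def)

lemma negative_simps [simp]:
  "negative None" "negative (Some (Atm X))" "negative (Some (A \<multimap> B))"
  "\<not> negative (Some \<I>)" "\<not> negative (Some (A \<otimes> B))"
  by (auto simp: negative_def)

lemma fderives_ctx_len: "fderives ph x S \<Gamma> C f \<Longrightarrow> ctx_len f = length \<Gamma>"
  by (induction rule: fderives.induct) auto

lemma fderives_positive: "fderives ph x S \<Gamma> C f \<Longrightarrow> ph \<noteq> RI_ph \<Longrightarrow> positive C"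
  using fderives_wf[of ph x S \<Gamma> C f] by (cases ph) (auto simp: wf_seq_def)

lemma fderives_negative: "fderives ph x S \<Gamma> C f \<Longrightarrow> ph \<in> {P_ph, F_ph} \<Longrightarrow> negative S"
  using fderives_wf[of ph x S \<Gamma> C f] by (cases ph) (auto simp: wf_seq_def)

text \<open>First of the inversion equivalences for untagged sequents. Well-formedness of the
  conclusion drops out where the premises imply it, so that derivations can be taken apart and built
  by rewriting.\<close>

lemma Blank_FLolliR [simp]:
  "fderives ph Blank S (plain \<Gamma>) C (FLolliR f) \<longleftrightarrow>
     ph = RI_ph \<and> (\<exists>A B. C = A \<multimap> B \<and> fderives RI_ph Blank S (plain (\<Gamma> @ [A])) B f)"
  by (auto elim!: fderives.cases[of _ _ _ _ _ "FLolliR f"] intro!: fderives.intros simp: wf_seq_Blank)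

lemma Blank_LI2RI [simp]:
  "fderives ph Blank S (plain \<Gamma>) C (LI2RI f) \<longleftrightarrow>
     ph = RI_ph \<and> fderives LI_ph Blank S (plain \<Gamma>) C f"
  by (auto elim!: fderives.cases[of _ _ _ _ _ "LI2RI f"] intro!: fderives.intros
      simp: wf_seq_Blank fderives_positive)

lemma Blank_FIL [simp]:
  "fderives ph Blank S (plain \<Gamma>) C (FIL f) \<longleftrightarrow>
     ph = LI_ph \<and> S = Some \<I> \<and> fderives LI_ph Blank None (plain \<Gamma>) C f"
  by (auto elim!: fderives.cases[of _ _ _ _ _ "FIL f"] intro!: fderives.intros
      simp: wf_seq_Blank fderives_positive)

lemma Blank_FTensL [simp]:
  "fderives ph Blank S (plain \<Gamma>) C (FTensL f) \<longleftrightarrow>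
     ph = LI_ph \<and> (\<exists>A B. S = Some (A \<otimes> B) \<and> fderives LI_ph Blank (Some A) (plain (B # \<Gamma>)) C f)"
  by (auto elim!: fderives.cases[of _ _ _ _ _ "FTensL f"] intro!: fderives.intros
      simp: wf_seq_Blank fderives_positive)

lemma Blank_P2LI [simp]:
  "fderives ph Blank S (plain \<Gamma>) C (P2LI f) \<longleftrightarrow>
     ph = LI_ph \<and> fderives P_ph Blank S (plain \<Gamma>) C f"
  by (auto elim!: fderives.cases[of _ _ _ _ _ "P2LI f"] intro!: fderives.intros
      simp: wf_seq_Blank fderives_positive fderives_negative)

lemma Blank_F2P [simp]:
  "fderives ph Blank S (plain \<Gamma>) C (F2P f) \<longleftrightarrow>
     ph = P_ph \<and> fderives F_ph Blank S (plain \<Gamma>) C f"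
  by (auto elim!: fderives.cases[of _ _ _ _ _ "F2P f"] intro!: fderives.intros
      simp: wf_seq_Blank fderives_positive fderives_negative)

lemma Blank_FPass [simp]:
  "fderives ph Blank S (plain \<Gamma>) C (FPass f) \<longleftrightarrow>
     ph = P_ph \<and> S = None \<and> (\<exists>A \<Delta>. \<Gamma> = A # \<Delta> \<and> fderives LI_ph Blank (Some A) (plain \<Delta>) C f)"
  (is "?L \<longleftrightarrow> ?R")
proof
  assume ?L then show ?R
    by cases (auto simp: plain_eq_Cons_conv untag_eq_plain)
next
  assume ?R then obtain A \<Delta> where "ph = P_ph" "S = None" and \<Gamma>: "\<Gamma> = A # \<Delta>"
    and f: "fderives LI_ph Blank (Some A) (plain \<Delta>) C f" by blast
  with fderives.f_pass[of A "plain \<Delta>" C f Blank] fderives_positive[OF f] show ?L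
    by (simp add: untag_eq_plain wf_seq_Blank)
qed

lemma Blank_FAx [simp]:
  "fderives ph Blank S (plain \<Gamma>) C (FAx X) \<longleftrightarrow>
     ph = F_ph \<and> S = Some (Atm X) \<and> \<Gamma> = [] \<and> C = Atm X"
  by (auto elim!: fderives.cases[of _ _ _ _ _ "FAx X"] intro!: fderives.intros simp: plain_def)

lemma Blank_FIR [simp]:
  "fderives ph Blank S (plain \<Gamma>) C FIR \<longleftrightarrow> ph = F_ph \<and> S = None \<and> \<Gamma> = [] \<and> C = \<I>"
  by (auto elim!: fderives.cases[of _ _ _ _ _ FIR] intro!: fderives.intros simp: plain_def)

text \<open>\<open>negative S\<close> stays: the left premise is in the RI phase, which allows any
  stoup. That premise is a tagged sequent in which no formula carries a tag yet, since \<otimes>R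
  strips all tags.\<close>

lemma Blank_FTensR [simp]:
  "fderives ph Blank S (plain \<Gamma>) C (FTensR f g) \<longleftrightarrow>
     ph = F_ph \<and> negative S \<and> (\<exists>A B \<Gamma>1 \<Gamma>2. C = A \<otimes> B \<and> \<Gamma> = \<Gamma>1 @ \<Gamma>2 \<and>
       fderives RI_ph Bullet S (plain \<Gamma>1) A f \<and> fderives RI_ph Blank None (plain \<Gamma>2) B g)"
  (is "?L \<longleftrightarrow> ?R")
proof
  assume ?L then show ?R
    by cases (fastforce simp: plain_eq_append_conv untag_eq_plain wf_seq_def)
next
  assume ?R then obtain A B \<Gamma>1 \<Gamma>2 where "ph = F_ph" "negative S" "C = A \<otimes> B" "\<Gamma> = \<Gamma>1 @ \<Gamma>2"
    "fderives RI_ph Bullet S (plain \<Gamma>1) A f" "fderives RI_ph Blank None (plain \<Gamma>2) B g" by blast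
  with fderives.f_tensR[of S "plain \<Gamma>1" A f "plain \<Gamma>2" B g Blank] show ?L
    by (simp add: untag_eq_plain wf_seq_Blank)
qed

lemma Blank_FLolliL [simp]:
  "fderives ph Blank S (plain \<Gamma>) C (FLolliL f g) \<longleftrightarrow>
     ph = F_ph \<and> (\<exists>A B \<Gamma>1 \<Gamma>2. S = Some (A \<multimap> B) \<and> \<Gamma> = \<Gamma>1 @ \<Gamma>2 \<and>
       fderives RI_ph Blank None (plain \<Gamma>1) A f \<and> fderives LI_ph Blank (Some B) (plain \<Gamma>2) C g)"
  (is "?L \<longleftrightarrow> ?R")
proof
  assume ?L then show ?R
    by cases (fastforce simp: plain_eq_append_conv untag_eq_plain)
next
  assume ?R then obtain A B \<Gamma>1 \<Gamma>2 where "ph = F_ph" "S = Some (A \<multimap> B)" "\<Gamma> = \<Gamma>1 @ \<Gamma>2"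
    "fderives RI_ph Blank None (plain \<Gamma>1) A f" "fderives LI_ph Blank (Some B) (plain \<Gamma>2) C g"
    by blast
  with fderives.f_lolliL[of "plain \<Gamma>1" A f B "plain \<Gamma>2" C g Blank] show ?L
    by (simp add: untag_eq_plain wf_seq_Blank fderives_positive)
qed

section \<open>Focused derivations represent unfocused ones\<close>

lemma emb_derives: "fderives ph x S \<Gamma> C f \<Longrightarrow> derives S (map fst \<Gamma>) C (emb f)"
  by (induction rule: fderives.induct) (auto intro: derives.intros)

lemma emb_derives_plain: "fderives ph x S (plain \<Gamma>) C f \<Longrightarrow> derives S \<Gamma> C (emb f)"
  using emb_derives[of ph x S "plain \<Gamma>" C f] by simp

lemma fderives_plain_ctx_len: "fderives ph x S (plain \<Gamma>) C f \<Longrightarrow> ctx_len f = length \<Gamma>"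
  by (auto dest: fderives_ctx_len)

lemma ceq_derives: "ceq S \<Gamma> A f g \<Longrightarrow> derives S \<Gamma> A f \<and> derives S \<Gamma> A g"
proof (induction rule: ceq.induct)
  case (tensR_pass A' \<Gamma> A f \<Delta> B g)
  then show ?case
    using derives.tensR[OF derives.pass] derives.pass[OF derives.tensR] by fastforce
next
  case (tensR_tensL A' B' \<Gamma> A f \<Delta> B g)
  then show ?case
    using derives.tensR[OF derives.tensL] derives.tensL[of _ _ "\<Gamma> @ \<Delta>"] derives.tensR by fastforce
next
  case (tensR_lolliL \<Gamma> A' f B' \<Delta> A g \<Lambda> B h)
  then show ?case
    using derives.tensR[OF derives.lolliL] derives.lolliL[OF _ derives.tensR] by fastforce
next
  case (ax_tens A B)
  have "derives (Some A) ([] @ [B]) (A \<otimes> B) (TensR (Ax A) (Pass (Ax B)))"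
    by (intro derives.intros)
  then show ?case by (auto intro: derives.intros)
next
  case (ax_lolli A B)
  have "derives (Some (A \<multimap> B)) ([A] @ []) B (LolliL (Pass (Ax A)) (Ax B))"
    by (intro derives.intros)
  then show ?case by (auto intro: derives.intros)
next
  case (pass_lolliR A' \<Gamma> A B f)
  then show ?case using derives.pass[of A' "\<Gamma> @ [A]"] by (auto intro: derives.intros)
next
  case (tensL_lolliR A' B' \<Gamma> A B f)
  then show ?case
    using derives.tensL[of A' B' "\<Gamma> @ [A]"] derives.lolliR[of _ "B' # \<Gamma>"]
    by (auto intro: derives.intros)
next
  case (lolliL_lolliR \<Gamma> A' f B' \<Delta> A B g)
  then show ?case
    using derives.lolliL[of \<Gamma> A' f B' "\<Delta> @ [A]"] by (auto intro: derives.intros)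
qed (auto intro: derives.intros)

section \<open>Commuting a left rule with right implications and the right tensor\<close>

text \<open>A left rule with all premises except the main one fixed: it turns \<open>S | \<Lambda>, \<Gamma> \<turnstile> C\<close> into
  \<open>S' | \<Lambda>', \<Gamma> \<turnstile> C\<close>.\<close>

locale left_rule =
  fixes S :: "'a stoup" and \<Lambda> :: "'a fma list" and S' :: "'a stoup" and \<Lambda>' :: "'a fma list"
    and K :: "'a deriv \<Rightarrow> 'a deriv"
  assumes cong: "ceq S (\<Lambda> @ \<Gamma>) C f f' \<Longrightarrow> ceq S' (\<Lambda>' @ \<Gamma>) C (K f) (K f')"
    and lolliR_perm: "derives S (\<Lambda> @ \<Gamma> @ [A]) B f
      \<Longrightarrow> ceq S' (\<Lambda>' @ \<Gamma>) (A \<multimap> B) (K (LolliR f)) (LolliR (K f))"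
    and tensR_perm: "derives S (\<Lambda> @ \<Gamma>) A f \<Longrightarrow> derives None \<Delta> B g
      \<Longrightarrow> ceq S' (\<Lambda>' @ \<Gamma> @ \<Delta>) (A \<otimes> B) (TensR (K f) g) (K (TensR f g))"

lemma left_rule_pass: "left_rule (Some A) [] None [A] Pass"
  by unfold_locales (auto intro: ceq.intros)

lemma left_rule_il: "left_rule None [] (Some \<I>) [] IL"
  by unfold_locales (auto intro: ceq.intros)

lemma left_rule_tensL: "left_rule (Some A) [B] (Some (A \<otimes> B)) [] TensL"
  by unfold_locales (auto intro: ceq.intros)

lemma left_rule_lolliL:
  "derives None \<Gamma> A f \<Longrightarrow> left_rule (Some B) [] (Some (A \<multimap> B)) \<Gamma> (LolliL f)"
  by unfold_locales (auto intro: ceq.intros)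

context left_rule
begin

lemma derives_K: "derives S (\<Lambda> @ \<Gamma>) C f \<Longrightarrow> derives S' (\<Lambda>' @ \<Gamma>) C (K f)"
  using cong[OF ceq.refl] ceq_derives by blast

text \<open>Iterates \<open>lolliR_perm\<close> from the outermost implication inwards. The
  outermost one discharges the first formula of \<Gamma>', which therefore moves to the end of
  \<Gamma> in the induction.\<close>

lemma lolliRs_perm:
  "derives S (\<Lambda> @ \<Gamma> @ \<Gamma>') C f \<Longrightarrow>
     ceq S' (\<Lambda>' @ \<Gamma>) (foldr Lolli \<Gamma>' C)
       (K ((LolliR ^^ length \<Gamma>') f)) ((LolliR ^^ length \<Gamma>') (K f))"
proof (induction \<Gamma>' arbitrary: \<Gamma>)
  case Nil
  then show ?case by (auto intro: ceq.refl derives_K)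
next
  case (Cons A \<Gamma>')
  have "derives S (\<Lambda> @ \<Gamma> @ [A]) (foldr Lolli \<Gamma>' C) ((LolliR ^^ length \<Gamma>') f)"
    using Cons.prems
  proof (induction \<Gamma>' arbitrary: \<Gamma> A)
    case (Cons B \<Gamma>')
    from Cons.IH[of "\<Gamma> @ [A]" B] Cons.prems show ?case by (auto intro: derives.lolliR)
  qed simp
  note lolliR_perm[OF this]
  moreover have "ceq S' (\<Lambda>' @ \<Gamma>) (A \<multimap> foldr Lolli \<Gamma>' C)
      (LolliR (K ((LolliR ^^ length \<Gamma>') f))) (LolliR ((LolliR ^^ length \<Gamma>') (K f)))"
    using Cons.IH[of "\<Gamma> @ [A]"] Cons.prems by (intro ceq.cong_lolliR) simp
  ultimately show ?case by (auto intro: ceq.trans)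
qed

text \<open>The induction step of \<open>push\<close> at a left rule \<open>K\<close>: first
  \<open>tensR_perm\<close> moves \<open>K\<close> into the left premise of \<otimes>R, then
  \<open>lolliRs_perm\<close> moves it inside the implications.\<close>

lemma tensR_lolliRs_perm:
  assumes h: "ceq S (\<Lambda> @ \<Gamma> @ \<Delta>) (foldr Lolli \<Gamma>' C \<otimes> B) h (TensR ((LolliR ^^ length \<Gamma>') f) g)"
    and f: "derives S (\<Lambda> @ \<Gamma> @ \<Gamma>') C f" and g: "derives None \<Delta> B g"
  shows "ceq S' (\<Lambda>' @ \<Gamma> @ \<Delta>) (foldr Lolli \<Gamma>' C \<otimes> B) (K h)
    (TensR ((LolliR ^^ length \<Gamma>') (K f)) g)"
proof -
  have f': "derives S (\<Lambda> @ \<Gamma>) (foldr Lolli \<Gamma>' C) ((LolliR ^^ length \<Gamma>') f)"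
    using f
  proof (induction \<Gamma>' arbitrary: \<Gamma>)
    case (Cons A \<Gamma>')
    from Cons.IH[of "\<Gamma> @ [A]"] Cons.prems show ?case by (auto intro: derives.lolliR)
  qed simp
  have "ceq S' ((\<Lambda>' @ \<Gamma>) @ \<Delta>) (foldr Lolli \<Gamma>' C \<otimes> B)
      (TensR (K ((LolliR ^^ length \<Gamma>') f)) g) (TensR ((LolliR ^^ length \<Gamma>') (K f)) g)"
    using lolliRs_perm[OF f] g by (intro ceq.cong_tensR ceq.refl)
  with ceq.trans[OF cong[OF h] ceq.sym[OF tensR_perm[OF f' g]]] show ?thesis
    by (auto intro: ceq.trans)
qed

text \<open>Serves all four left rules at once: \<open>k\<close> is the rule in the LI phase,
  \<open>K\<close> its unfocused counterpart. The permutation \<open>lolliR_perm\<close> is used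
  once for each implication that \<open>under\<close> crosses.\<close>

lemma under_RI:
  assumes "fderives RI_ph Blank S (plain (\<Lambda> @ \<Gamma>)) C f"
    and LI: "\<And>\<Gamma> C f. fderives LI_ph Blank S (plain (\<Lambda> @ \<Gamma>)) C f
      \<Longrightarrow> fderives LI_ph Blank S' (plain (\<Lambda>' @ \<Gamma>)) C (k f)"
    and emb: "\<And>f. emb (k f) = K (emb f)"
  shows "fderives RI_ph Blank S' (plain (\<Lambda>' @ \<Gamma>)) C (under k f) \<and>
    ceq S' (\<Lambda>' @ \<Gamma>) C (emb (under k f)) (K (emb f))"
  using assms(1)
proof (induction f arbitrary: \<Gamma> C rule: fderiv.induct)
  case (FLolliR f)
  then obtain A B where C: "C = A \<multimap> B"
    and f: "fderives RI_ph Blank S (plain (\<Lambda> @ \<Gamma> @ [A])) B f"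
    by auto
  note IH = FLolliR.IH[OF f]
  have "derives S (\<Lambda> @ \<Gamma> @ [A]) B (emb f)" using emb_derives_plain[OF f] .
  note lolliR_perm[OF this]
  moreover have "ceq S' (\<Lambda>' @ \<Gamma>) (A \<multimap> B) (LolliR (emb (under k f))) (LolliR (K (emb f)))"
    using IH by (intro ceq.cong_lolliR) simp
  ultimately show ?case using IH C by (auto intro: ceq.sym ceq.trans)
next
  case (LI2RI f)
  then have "fderives LI_ph Blank S' (plain (\<Lambda>' @ \<Gamma>)) C (k f)"
    by (intro LI) simp
  then show ?case
    using emb emb_derives_plain[of LI_ph Blank S' "\<Lambda>' @ \<Gamma>" C "k f"]
    by (auto intro!: ceq.refl)
qed simp_all

end

section \<open>Admissibility of the left rules in the RI phase\<close>

lemma pass_RI: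
  assumes "fderives RI_ph Blank (Some A) (plain \<Gamma>) C f"
  shows "fderives RI_ph Blank None (plain (A # \<Gamma>)) C (pass_RI f)"
    and "ceq None (A # \<Gamma>) C (emb (pass_RI f)) (Pass (emb f))"
  using left_rule.under_RI[OF left_rule_pass, of A \<Gamma> C f "\<lambda>f. P2LI (FPass f)"] assms
  by (auto simp: pass_RI_def)

lemma il_RI:
  assumes "fderives RI_ph Blank None (plain \<Gamma>) C f"
  shows "fderives RI_ph Blank (Some \<I>) (plain \<Gamma>) C (il_RI f)"
    and "ceq (Some \<I>) \<Gamma> C (emb (il_RI f)) (IL (emb f))"
  using left_rule.under_RI[OF left_rule_il, of \<Gamma> C f FIL] assms
  by (auto simp: il_RI_def)

lemma tensL_RI:
  assumes "fderives RI_ph Blank (Some A) (plain (B # \<Gamma>)) C f"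
  shows "fderives RI_ph Blank (Some (A \<otimes> B)) (plain \<Gamma>) C (tensL_RI f)"
    and "ceq (Some (A \<otimes> B)) \<Gamma> C (emb (tensL_RI f)) (TensL (emb f))"
  using left_rule.under_RI[OF left_rule_tensL, of A B \<Gamma> C f FTensL] assms
  by (auto simp: tensL_RI_def)

lemma lolliL_RI:
  assumes f: "fderives RI_ph Blank None (plain \<Gamma>) A f"
    and g: "fderives RI_ph Blank (Some B) (plain \<Delta>) C g"
  shows "fderives RI_ph Blank (Some (A \<multimap> B)) (plain (\<Gamma> @ \<Delta>)) C (lolliL_RI f g)"
    and "ceq (Some (A \<multimap> B)) (\<Gamma> @ \<Delta>) C (emb (lolliL_RI f g)) (LolliL (emb f) (emb g))"
proof -
  interpret left_rule "Some B" "[]" "Some (A \<multimap> B)" \<Gamma> "LolliL (emb f)"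
    by (rule left_rule_lolliL[OF emb_derives_plain[OF f]])
  show "fderives RI_ph Blank (Some (A \<multimap> B)) (plain (\<Gamma> @ \<Delta>)) C (lolliL_RI f g)"
    "ceq (Some (A \<multimap> B)) (\<Gamma> @ \<Delta>) C (emb (lolliL_RI f g)) (LolliL (emb f) (emb g))"
    using under_RI[of \<Delta> C g "\<lambda>g. P2LI (F2P (FLolliL f g))"] f g
    by (auto simp: lolliL_RI_def)
qed

section \<open>Admissibility of the right tensor rule in the RI phase\<close>

lemma wf_ctx_Bullet_butlast: "wf_ctx Bullet (\<Xi> @ [a]) \<Longrightarrow> wf_ctx Bullet \<Xi>"
proof -
  assume "wf_ctx Bullet (\<Xi> @ [a])"
  then obtain \<Delta> \<Lambda> where *: "\<Xi> @ [a] = plain \<Delta> @ map (\<lambda>A. (A, Bullet)) \<Lambda>"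
    by (auto simp: wf_ctx_def)
  show ?thesis
  proof (cases \<Lambda> rule: rev_cases)
    case Nil
    with * have "\<Xi> = plain (butlast \<Delta>) @ map (\<lambda>A. (A, Bullet)) []"
      by (simp add: plain_def map_butlast) (metis butlast_snoc)
    then show ?thesis by (auto simp: wf_ctx_def)
  next
    case (snoc \<Lambda>' A)
    with * have "\<Xi> = plain \<Delta> @ map (\<lambda>A. (A, Bullet)) \<Lambda>'" by simp
    then show ?thesis by (auto simp: wf_ctx_def)
  qed
qed

text \<open>Tags originate here: read upwards, \<multimap>R in a tagged sequent puts the discharged
  formula, tagged, at the right end of the context.\<close>

lemma lolliRs_Bullet:
  "fderives LI_ph Bullet S (\<Xi> @ map (\<lambda>A. (A, Bullet)) \<Gamma>) C f
    \<Longrightarrow> fderives RI_ph Bullet S \<Xi> (foldr Lolli \<Gamma> C) (lolliRs (length \<Gamma>) (LI2RI f))"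
proof (induction \<Gamma> arbitrary: \<Xi>)
  case Nil
  then show ?case
    by (auto intro!: fderives.f_li2ri fderives_positive dest: fderives_wf simp: wf_seq_def)
next
  case (Cons A \<Gamma>)
  from Cons.IH[of "\<Xi> @ [(A, Bullet)]"] Cons.prems
  have f: "fderives RI_ph Bullet S (\<Xi> @ [(A, Bullet)]) (foldr Lolli \<Gamma> C)
      (lolliRs (length \<Gamma>) (LI2RI f))" by simp
  from fderives_wf[OF f] have "wf_ctx Bullet \<Xi>"
    by (auto simp: wf_seq_def intro: wf_ctx_Bullet_butlast)
  with f show ?case by (auto intro!: fderives.f_lolliR simp: wf_seq_def)
qed

text \<open>Axioms and right rules accept any tags. A left rule that is not movable uses a formula
  of \<Gamma>', which is tagged here, as the tagged forms of pass and \<multimap>L demand. These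
  rules strip the tags from their premises, so the term does not change.\<close>

lemma immovable_Bullet:
  assumes "fderives ph Blank S (plain (\<Gamma> @ \<Gamma>')) C f" "ph \<in> {P_ph, F_ph}"
    "\<not> movable f (length \<Gamma>')"
  shows "fderives ph Bullet S (plain \<Gamma> @ map (\<lambda>A. (A, Bullet)) \<Gamma>') C f"
  using assms
proof (induction f arbitrary: ph rule: fderiv.induct)
  case (FPass f)
  then obtain A \<Delta> where *: "ph = P_ph" "S = None" "\<Gamma> @ \<Gamma>' = A # \<Delta>"
    and f: "fderives LI_ph Blank (Some A) (plain \<Delta>) C f" by auto
  from FPass.prems(3) fderives_plain_ctx_len[OF f] have "length \<Delta> < length \<Gamma>'" by simp
  \<comment> \<open>By length, the passed formula is the first one of \<Gamma>' and nothing precedes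
    it.\<close>
  with *(3) have "\<Gamma> = []" "\<Gamma>' = A # \<Delta>" by (auto simp: append_eq_Cons_conv)
  moreover have "wf_ctx Bullet ((A, Bullet) # map (\<lambda>A. (A, Bullet)) \<Delta>)"
    unfolding wf_ctx_def tag.case by (intro exI[of _ "[]"] exI[of _ "A # \<Delta>"]) simp
  ultimately show ?case
    using * f fderives.f_pass[of A "map (\<lambda>A. (A, Bullet)) \<Delta>" C f Bullet] fderives_positive[OF f]
    by (simp add: untag_eq_plain wf_seq_def comp_def)
next
  case (F2P f)
  then have "fderives F_ph Bullet S (plain \<Gamma> @ map (\<lambda>A. (A, Bullet)) \<Gamma>') C f" by auto
  with F2P.prems show ?case
    using fderives_wf[of F_ph Bullet S] by (auto intro!: fderives.f_f2p simp: wf_seq_def)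
next
  case (FAx X)
  then show ?case by (auto intro: fderives.f_ax)
next
  case FIR
  then show ?case by (auto intro: fderives.f_ir)
next
  let ?\<Xi> = "plain \<Gamma> @ map (\<lambda>A. (A, Bullet)) \<Gamma>'"
  have fst: "map fst ?\<Xi> = \<Gamma> @ \<Gamma>'" by (simp add: comp_def)
  have wf: "wf_ctx Bullet ?\<Xi>" by (auto simp: wf_ctx_def)
  {
    case (FTensR f g)
    then obtain A B \<Gamma>1 \<Gamma>2 where *: "ph = F_ph" "negative S" "C = A \<otimes> B" "\<Gamma> @ \<Gamma>' = \<Gamma>1 @ \<Gamma>2"
      "fderives RI_ph Bullet S (plain \<Gamma>1) A f" "fderives RI_ph Blank None (plain \<Gamma>2) B g" by auto
    \<comment> \<open>The boundary between the premises may fall inside \<Gamma> or inside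
      \<Gamma>', so the tagged context is cut by position.\<close>
    from fst *(4) have "map fst (take (length \<Gamma>1) ?\<Xi>) = \<Gamma>1"
      "map fst (drop (length \<Gamma>1) ?\<Xi>) = \<Gamma>2"
      by (metis append_eq_conv_conj take_map, metis append_eq_conv_conj drop_map)
    with * wf fderives.f_tensR[of S "take (length \<Gamma>1) ?\<Xi>" A f "drop (length \<Gamma>1) ?\<Xi>" B g Bullet]
    show ?case by (simp add: untag_eq_plain wf_seq_def del: take_append drop_append)
  next
    case (FLolliL f g)
    then obtain A B \<Gamma>1 \<Gamma>2 where *: "ph = F_ph" "S = Some (A \<multimap> B)" "\<Gamma> @ \<Gamma>' = \<Gamma>1 @ \<Gamma>2"
      and fg: "fderives RI_ph Blank None (plain \<Gamma>1) A f" "fderives LI_ph Blank (Some B) (plain \<Gamma>2) C g"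
      by auto
    from FLolliL.prems(3) fderives_plain_ctx_len[OF fg(2)] have "length \<Gamma>2 < length \<Gamma>'" by simp
    \<comment> \<open>The right premise has fewer context formulae than \<Gamma>', so the left one
      contains the first formula \<open>D\<close> of \<Gamma>'; its tag meets the side condition of
      \<multimap>L.\<close>
    with *(3) obtain D \<Lambda> where \<Lambda>: "\<Gamma>1 = \<Gamma> @ D # \<Lambda>" "\<Gamma>' = D # \<Lambda> @ \<Gamma>2"
      by (auto simp: append_eq_append_conv2 append_eq_Cons_conv) (metis append_Cons append_Nil
          length_append less_not_refl list.exhaust not_add_less2)+
    let ?\<Xi>1 = "plain \<Gamma> @ map (\<lambda>A. (A, Bullet)) (D # \<Lambda>)"
    show ?case
      using fderives.f_lolliL[of ?\<Xi>1 A f B "map (\<lambda>A. (A, Bullet)) \<Gamma>2" C g Bullet] * fg wf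
        fderives_positive[OF fg(2)]
      by (auto simp: \<Lambda> untag_eq_plain wf_seq_def comp_def)
  }
qed simp_all

lemma emb_lolliRs: "emb (lolliRs n f) = (LolliR ^^ n) (emb f)"
  by (induction n) auto

text \<open>Generalises admissibility of \<otimes>R to the formulae \<Gamma>' whose implications
  have been crossed so far. The last assumption carries the outcome of the test made at
  \<open>P2LI\<close> through the P and F phases.\<close>

lemma push:
  assumes "fderives ph Blank S (plain (\<Gamma> @ \<Gamma>')) C f"
    and g: "fderives RI_ph Blank None (plain \<Delta>) B g"
    and "ph \<in> {P_ph, F_ph} \<Longrightarrow> movable f (length \<Gamma>')"
  shows "fderives ph Blank S (plain (\<Gamma> @ \<Delta>)) (foldr Lolli \<Gamma>' C \<otimes> B) (push f (length \<Gamma>') g) \<and>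
    ceq S (\<Gamma> @ \<Delta>) (foldr Lolli \<Gamma>' C \<otimes> B) (emb (push f (length \<Gamma>') g))
      (TensR ((LolliR ^^ length \<Gamma>') (emb f)) (emb g))"
  using assms(1,3)
proof (induction f arbitrary: ph S \<Gamma> \<Gamma>' C rule: fderiv.induct)
  case (FLolliR f)
  then obtain A C' where "ph = RI_ph" "C = A \<multimap> C'"
    and "fderives RI_ph Blank S (plain (\<Gamma> @ \<Gamma>' @ [A])) C' f" by auto
  \<comment> \<open>The implication just crossed is the innermost one so far, so its formula joins
    \<Gamma>' at the right end.\<close>
  with FLolliR.IH[of RI_ph S \<Gamma> "\<Gamma>' @ [A]" C'] show ?case by (simp add: funpow_swap1)
next
  case (LI2RI f)
  then show ?case using LI2RI.IH[of LI_ph] by auto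
next
  case (FIL f)
  then have f: "ph = LI_ph" "S = Some \<I>" "fderives LI_ph Blank None (plain (\<Gamma> @ \<Gamma>')) C f"
    by auto
  with left_rule.tensR_lolliRs_perm[OF left_rule_il, of \<Gamma> \<Delta> \<Gamma>' C B] FIL.IH[OF f(3)]
    emb_derives_plain[OF f(3)] emb_derives_plain[OF g]
  show ?case by simp
next
  case (FTensL f)
  then obtain A' B' where f: "ph = LI_ph" "S = Some (A' \<otimes> B')"
      "fderives LI_ph Blank (Some A') (plain ((B' # \<Gamma>) @ \<Gamma>')) C f"
    by auto
  \<comment> \<open>\<otimes>L adds \<open>B'\<close> at the left end of the context, away from
    \<Gamma>', so it commutes without a test.\<close>
  with left_rule.tensR_lolliRs_perm[OF left_rule_tensL, of A' B' \<Gamma> \<Delta> \<Gamma>' C B] FTensL.IH[OF f(3)]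
    emb_derives_plain[OF f(3)] emb_derives_plain[OF g]
  show ?case by auto
next
  case (P2LI f)
  then have f: "ph = LI_ph" "fderives P_ph Blank S (plain (\<Gamma> @ \<Gamma>')) C f" by auto
  show ?case
  proof (cases "movable f (length \<Gamma>')")
    case True
    with P2LI.IH[OF f(2)] f(1) show ?thesis by simp
  next
    \<comment> \<open>\<otimes>R stays here: \<Gamma>' is tagged and then discharged to form its
      left premise. The embedded term is literally the right-hand side.\<close>
    case False
    from f(2) have "negative S" "positive C" by (auto intro: fderives_negative fderives_positive)
    then have "fderives LI_ph Bullet S (plain \<Gamma> @ map (\<lambda>A. (A, Bullet)) \<Gamma>') C (P2LI f)"
      by (intro fderives.f_p2li immovable_Bullet f(2)) (auto simp: False wf_seq_def wf_ctx_def)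
    from lolliRs_Bullet[OF this] g f(1) \<open>negative S\<close> False
    have "fderives ph Blank S (plain (\<Gamma> @ \<Delta>)) (foldr Lolli \<Gamma>' C \<otimes> B) (push (P2LI f) (length \<Gamma>') g)"
      by auto
    with emb_derives_plain[OF this] show ?thesis
      using False by (auto simp: emb_lolliRs intro: ceq.refl)
  qed
next
  case (FPass f)
  then obtain A \<Gamma>1 where *: "ph = P_ph" "S = None" "\<Gamma> @ \<Gamma>' = A # \<Gamma>1"
    and f: "fderives LI_ph Blank (Some A) (plain \<Gamma>1) C f" by auto
  from FPass.prems(2) fderives_plain_ctx_len[OF f] * have "length \<Gamma>' \<le> length \<Gamma>1" by simp
  with *(3) obtain \<Gamma>2 where \<Gamma>: "\<Gamma> = A # \<Gamma>2" "\<Gamma>1 = \<Gamma>2 @ \<Gamma>'"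
    by (auto simp: append_eq_Cons_conv)
  from left_rule.tensR_lolliRs_perm[OF left_rule_pass, of A \<Gamma>2 \<Delta> \<Gamma>' C B]
    FPass.IH[OF f[unfolded \<Gamma>]] emb_derives_plain[OF f] emb_derives_plain[OF g] *
  show ?case by (simp add: \<Gamma>)
next
  case (F2P f)
  then show ?case using F2P.IH[of F_ph] by auto
next
  case (FLolliL f h)
  then obtain A B' \<Gamma>1 \<Gamma>2 where *: "ph = F_ph" "S = Some (A \<multimap> B')" "\<Gamma> @ \<Gamma>' = \<Gamma>1 @ \<Gamma>2"
    and f: "fderives RI_ph Blank None (plain \<Gamma>1) A f"
    and h: "fderives LI_ph Blank (Some B') (plain \<Gamma>2) C h"
    by auto
  \<comment> \<open>Movability places the whole context of the left premise inside \<Gamma>.\<close>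
  from FLolliL.prems(2) fderives_plain_ctx_len[OF h] * have "length \<Gamma>' \<le> length \<Gamma>2" by simp
  with *(3) obtain \<Lambda> where \<Lambda>: "\<Gamma> = \<Gamma>1 @ \<Lambda>" "\<Gamma>2 = \<Lambda> @ \<Gamma>'"
    by (auto simp: append_eq_append_conv2)
  note IH = FLolliL.IH(2)[OF h[unfolded \<Lambda>]]
  from left_rule.tensR_lolliRs_perm[OF left_rule_lolliL[OF emb_derives_plain[OF f]],
      of B' \<Lambda> \<Delta> \<Gamma>' C B]
    IH emb_derives_plain[OF h] emb_derives_plain[OF g] * f
  show ?case by (auto simp: \<Lambda>)
qed auto

lemma tensR_RI:
  assumes "fderives RI_ph Blank S (plain \<Gamma>) A f" "fderives RI_ph Blank None (plain \<Delta>) B g"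
  shows "fderives RI_ph Blank S (plain (\<Gamma> @ \<Delta>)) (A \<otimes> B) (tensR_RI f g)"
    and "ceq S (\<Gamma> @ \<Delta>) (A \<otimes> B) (emb (tensR_RI f g)) (TensR (emb f) (emb g))"
  using push[of RI_ph S \<Gamma> "[]" A f \<Delta> B g] assms by (simp_all add: tensR_RI_def)

section \<open>Identity expansion and correctness of focusing\<close>

lemma ax_RI:
  "fderives RI_ph Blank (Some A) [] A (ax_RI A) \<and> ceq (Some A) [] A (emb (ax_RI A)) (Ax A)"
proof (induction A)
  case (Atm X)
  show ?case
    using Blank_LI2RI[of RI_ph "Some (Atm X)" "[]"] Blank_P2LI[of LI_ph "Some (Atm X)" "[]"]
      Blank_F2P[of P_ph "Some (Atm X)" "[]"] by (auto intro: ceq.refl derives.ax fderives.f_ax)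
next
  case Unit
  have "fderives RI_ph Blank None (plain []) \<I> (LI2RI (P2LI (F2P FIR)))"
    by (simp del: plain_Nil)
  from il_RI[OF this] show ?case by (auto intro: ceq.trans ceq.sym[OF ceq.ax_I])
next
  case (Tensor A B)
  from Tensor have A: "fderives RI_ph Blank (Some A) (plain []) A (ax_RI A)"
    and B: "fderives RI_ph Blank (Some B) (plain []) B (ax_RI B)" by auto
  note pB = pass_RI[OF B]
  note t = tensR_RI[OF A pB(1), unfolded append_Nil]
  have "ceq None [B] B (emb (pass_RI (ax_RI B))) (Pass (Ax B))"
    using Tensor by (intro ceq.trans[OF pB(2)] ceq.cong_pass) auto
  with Tensor have "ceq (Some A) ([] @ [B]) (A \<otimes> B)
      (TensR (emb (ax_RI A)) (emb (pass_RI (ax_RI B)))) (TensR (Ax A) (Pass (Ax B)))"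
    by (intro ceq.cong_tensR) auto
  with t(2) have "ceq (Some A) [B] (A \<otimes> B) (emb (tensR_RI (ax_RI A) (pass_RI (ax_RI B))))
      (TensR (Ax A) (Pass (Ax B)))"
    by (auto intro: ceq.trans)
  from ceq.cong_tensL[OF this] tensL_RI[OF t(1)] show ?case
    by (auto intro: ceq.trans ceq.sym[OF ceq.ax_tens])
next
  case (Lolli A B)
  from Lolli have A: "fderives RI_ph Blank (Some A) (plain []) A (ax_RI A)"
    and B: "fderives RI_ph Blank (Some B) (plain []) B (ax_RI B)" by auto
  note pA = pass_RI[OF A]
  note t = lolliL_RI[OF pA(1) B, unfolded append_Nil2]
  have "ceq None [A] A (emb (pass_RI (ax_RI A))) (Pass (Ax A))"
    using Lolli by (intro ceq.trans[OF pA(2)] ceq.cong_pass) auto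
  with Lolli have "ceq (Some (A \<multimap> B)) ([A] @ []) B
      (LolliL (emb (pass_RI (ax_RI A))) (emb (ax_RI B))) (LolliL (Pass (Ax A)) (Ax B))"
    by (intro ceq.cong_lolliL) auto
  with t(2) have "ceq (Some (A \<multimap> B)) ([] @ [A]) B (emb (lolliL_RI (pass_RI (ax_RI A)) (ax_RI B)))
      (LolliL (Pass (Ax A)) (Ax B))"
    by (auto intro: ceq.trans)
  from ceq.cong_lolliR[OF this] t(1) Blank_FLolliR[of RI_ph "Some (A \<multimap> B)" "[]"] show ?case
    by (auto intro: ceq.trans ceq.sym[OF ceq.ax_lolli])
qed

text \<open>Since \<open>emb\<close> undoes \<open>focus\<close> up to congruence, derivations with
  equal focused forms are congruent.\<close>

lemma focus_correct:
  "derives S \<Gamma> A f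
    \<Longrightarrow> fderives RI_ph Blank S (plain \<Gamma>) A (focus f) \<and> ceq S \<Gamma> A (emb (focus f)) f"
proof (induction rule: derives.induct)
  case (ax A)
  then show ?case using ax_RI by simp
next
  case (pass A \<Gamma> C f)
  then show ?case using pass_RI[of A \<Gamma> C "focus f"] by (auto intro: ceq.trans ceq.cong_pass)
next
  case (lolliL \<Gamma> A f B \<Delta> C g)
  then show ?case
    using lolliL_RI[of \<Gamma> A "focus f" B \<Delta> C "focus g"] by (auto intro: ceq.trans ceq.cong_lolliL)
next
  case (lolliR S \<Gamma> A B f)
  then show ?case by (auto intro: ceq.cong_lolliR)
next
  case (il \<Gamma> C f)
  then show ?case using il_RI[of \<Gamma> C "focus f"] by (auto intro: ceq.trans ceq.cong_il)
next
  case (tensL A B \<Gamma> C f)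
  then show ?case using tensL_RI[of A B \<Gamma> C "focus f"] by (auto intro: ceq.trans ceq.cong_tensL)
next
  case ir
  have "fderives RI_ph Blank None (plain []) \<I> (LI2RI (P2LI (F2P FIR)))"
    by (simp del: plain_Nil)
  then show ?case by (auto intro: ceq.refl derives.ir)
next
  case (tensR S \<Gamma> A f \<Delta> B g)
  then show ?case
    using tensR_RI[of S \<Gamma> A "focus f" \<Delta> B "focus g"] by (auto intro: ceq.trans ceq.cong_tensR)
qed

section \<open>Congruent derivations have the same focused form\<close>

text \<open>Turns the permutations of \<otimes>R past left rules into identities:
  \<open>push\<close> and \<open>under\<close> cross the same implications. The bound on
  \<open>n\<close> keeps the discharged formulae out of reach of \<open>k\<close>, so any movability
  test succeeds.\<close>

lemma push_under:
  assumes "fderives RI_ph Blank S (plain \<Gamma>) C f" "n \<le> length \<Gamma>"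
    and "\<And>f n. n \<le> ctx_len f \<Longrightarrow> push (k f) n g = k (push f n g)"
  shows "push (under k f) n g = under k (push f n g)"
  using assms(1,2)
proof (induction f arbitrary: \<Gamma> C n rule: fderiv.induct)
  case (FLolliR f)
  then obtain A B where "fderives RI_ph Blank S (plain (\<Gamma> @ [A])) B f" by auto
  with FLolliR show ?case by fastforce
next
  case (LI2RI f)
  then show ?case using assms(3) fderives_plain_ctx_len by fastforce
qed simp_all

text \<open>The axiom equations hold by the clauses of \<open>ax_RI\<close>, the permutations with
  \<multimap>R by the clause of \<open>under\<close> for \<open>FLolliR\<close>, and those with
  \<otimes>R by \<open>push_under\<close> with no formula discharged yet.\<close>

lemma ceq_imp_focus_eq: "ceq S \<Gamma> A f g \<Longrightarrow> focus f = focus g"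
proof (induction rule: ceq.induct)
  case (tensR_pass A' \<Gamma> A f \<Delta> B g)
  then show ?case
    using focus_correct push_under by (fastforce simp: tensR_RI_def pass_RI_def)
next
  case (tensR_il \<Gamma> A f \<Delta> B g)
  then show ?case
    using focus_correct push_under by (fastforce simp: tensR_RI_def il_RI_def)
next
  case (tensR_tensL A' B' \<Gamma> A f \<Delta> B g)
  then show ?case
    using focus_correct push_under by (fastforce simp: tensR_RI_def tensL_RI_def)
next
  case (tensR_lolliL \<Gamma> A' f B' \<Delta> A g \<Lambda> B h)
  then show ?case
    using focus_correct push_under by (fastforce simp: tensR_RI_def lolliL_RI_def)
qed (simp_all add: pass_RI_def il_RI_def tensL_RI_def lolliL_RI_def)

lemma focus_eq_iff:
  assumes "derives S \<Gamma> A f" "derives S \<Gamma> A g"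
  shows "ceq S \<Gamma> A f g \<longleftrightarrow> focus f = focus g"
  using assms by (metis focus_correct ceq_imp_focus_eq ceq.sym ceq.trans)

lemma FSkMCl_hom_eq_iff:
  assumes "\<phi> \<in> FSkMCl_hom A B" "\<psi> \<in> FSkMCl_hom A B" "f \<in> \<phi>" "g \<in> \<psi>"
  shows "\<phi> = \<psi> \<longleftrightarrow> focus f = focus g"
proof -
  let ?D = "{f. derives (Some A) [] B f}" and ?R = "{(f, g). ceq (Some A) [] B f g}"
  have equiv: "equiv ?D ?R"
    by (intro equivI)
      (auto simp: refl_on_def intro!: symI transI dest: ceq_derives intro: ceq.refl ceq.sym ceq.trans)
  from assms have "f \<in> ?D" "g \<in> ?D"
    using in_quotient_imp_subset[OF equiv] unfolding FSkMCl_hom_def by blast+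
  moreover have "\<phi> = \<psi> \<longleftrightarrow> (f, g) \<in> ?R"
    using quotient_eq_iff[OF equiv] assms unfolding FSkMCl_hom_def by blast
  ultimately show ?thesis using focus_eq_iff[of "Some A" "[]" B f g] by simp
qed

section \<open>Focusing is computable\<close>

subsection \<open>Evaluation as a rewrite system\<close>

text \<open>Since evaluation is deterministic, it is described by equivalences, which the simplifier can
  use to run programs. Calls are kept behind \<open>returns\<close> so that function bodies are not unfolded.\<close>

definition returns :: "expr list \<Rightarrow> nat \<Rightarrow> 'a sexp list \<Rightarrow> 'a sexp \<Rightarrow> bool" where
  "returns p i us v \<longleftrightarrow> i < length p \<and> eval p us (p ! i) v"

lemma evals_simps [simp]:
  "evals p \<rho> [] us \<longleftrightarrow> us = []"
  "evals p \<rho> (a # as) us \<longleftrightarrow> (\<exists>u us'. us = u # us' \<and> eval p \<rho> a u \<and> evals p \<rho> as us')"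
  by (auto elim: evals.cases intro: eval_evals.intros)

lemma eval_simps [simp]:
  "eval p \<rho> (Var n) v \<longleftrightarrow> n < length \<rho> \<and> v = \<rho> ! n"
  "eval p \<rho> NilE v \<longleftrightarrow> v = SNil"
  "eval p \<rho> (ConsE a b) v \<longleftrightarrow> (\<exists>u w. v = SCons u w \<and> eval p \<rho> a u \<and> eval p \<rho> b w)"
  "eval p \<rho> (CarE a) v \<longleftrightarrow> (\<exists>w. eval p \<rho> a (SCons v w))"
  "eval p \<rho> (CdrE a) v \<longleftrightarrow> (\<exists>u. eval p \<rho> a (SCons u v))"
  "eval p \<rho> (AtomE a) v \<longleftrightarrow> (\<exists>u. eval p \<rho> a u \<and> v = enc_bool (atomic u))"
  "eval p \<rho> (EqE a b) v \<longleftrightarrow>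
     (\<exists>u w. eval p \<rho> a u \<and> eval p \<rho> b w \<and> atomic u \<and> atomic w \<and> v = enc_bool (u = w))"
  "eval p \<rho> (IfE c a b) v \<longleftrightarrow> (\<exists>w. eval p \<rho> c w \<and> (if w = SNil then eval p \<rho> b v else eval p \<rho> a v))"
  "eval p \<rho> (Call i as) v \<longleftrightarrow> (\<exists>us. evals p \<rho> as us \<and> returns p i us v)"
  by (rule iffI; (erule eval.cases)?; auto simp: returns_def intro: eval_evals.intros split: if_splits)+

lemma enc_bool_eq_SNil [simp]: "enc_bool b = SNil \<longleftrightarrow> \<not> b"
  by (cases b) auto

lemma num_inject [simp]: "num m = num n \<longleftrightarrow> m = n"
proof (induction m arbitrary: n)
  case 0 show ?case by (cases n) auto
next
  case (Suc m) then show ?case by (cases n) auto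
qed

lemma node_inject [simp]: "node k us = node l vs \<longleftrightarrow> k = l \<and> us = vs"
proof -
  have "foldr SCons us SNil = foldr SCons vs SNil \<Longrightarrow> us = vs" for us vs :: "'a sexp list"
  proof (induction us arbitrary: vs)
    case Nil then show ?case by (cases vs) auto
  next
    case (Cons u us) then show ?case by (cases vs) auto
  qed
  then show ?thesis by (auto simp: node_def)
qed

text \<open>Lets a program test equality of derivations on their codes.\<close>

lemma enc_fderiv_inject [simp]: "enc_fderiv f = enc_fderiv g \<longleftrightarrow> f = g"
  by (induction f arbitrary: g) (case_tac g; simp)+

subsection \<open>Expressions for terms\<close>

primrec numE :: "nat \<Rightarrow> expr" where
  "numE 0 = NilE"
| "numE (Suc n) = ConsE NilE (numE n)"

definition nodeE :: "nat \<Rightarrow> expr list \<Rightarrow> expr" where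
  "nodeE k es = ConsE (numE k) (foldr ConsE es NilE)"

text \<open>\<open>Suc j\<close> because the first cell of a node holds the constructor
  number.\<close>

definition argE :: "nat \<Rightarrow> expr" where
  "argE j = CarE ((CdrE ^^ Suc j) (Var 0))"

text \<open>Case distinction on a unary number: each test strips one cell, and the last branch is
  taken without a test.\<close>

fun selectE :: "expr \<Rightarrow> expr list \<Rightarrow> expr" where
  "selectE t [] = NilE"
| "selectE t [e] = e"
| "selectE t (e # es) = IfE t (selectE (CdrE t) es) e"

definition caseE :: "expr list \<Rightarrow> expr" where
  "caseE = selectE (CarE (Var 0))"

lemma eval_numE [simp]: "eval p \<rho> (numE n) v \<longleftrightarrow> v = num n"
  by (induction n arbitrary: v) auto

lemma eval_nodeE [simp]: "eval p \<rho> (nodeE k es) v \<longleftrightarrow> (\<exists>us. evals p \<rho> es us \<and> v = node k us)"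
proof -
  have "eval p \<rho> (foldr ConsE es NilE) v \<longleftrightarrow> (\<exists>us. evals p \<rho> es us \<and> v = foldr SCons us SNil)" for v
    by (induction es arbitrary: v) fastforce+
  then show ?thesis by (auto simp: nodeE_def node_def)
qed

lemma eval_argE [simp]:
  assumes "j < length us"
  shows "eval p (node k us # \<rho>) (argE j) v \<longleftrightarrow> v = us ! j"
proof -
  have "eval p (node k us # \<rho>) ((CdrE ^^ Suc j) (Var 0)) v
      \<longleftrightarrow> v = foldr SCons (drop j us) SNil" if "j \<le> length us" for v
    using that
  proof (induction j arbitrary: v)
    case 0
    then show ?case by (simp add: node_def)
  next
    case (Suc j)
    then have "drop j us = us ! j # drop (Suc j) us" by (simp add: Cons_nth_drop_Suc)
    with Suc show ?case by simp
  qed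
  with assms show ?thesis by (simp add: argE_def Cons_nth_drop_Suc[symmetric])
qed

lemma eval_selectE:
  "\<lbrakk>\<And>v. eval p \<rho> t v \<longleftrightarrow> v = num k; k < length es\<rbrakk>
    \<Longrightarrow> eval p \<rho> (selectE t es) v \<longleftrightarrow> eval p \<rho> (es ! k) v"
proof (induction t es arbitrary: k rule: selectE.induct)
  case (3 t e e' es)
  then show ?case by (cases k) auto
qed auto

lemma eval_caseE [simp]:
  "k < length es
    \<Longrightarrow> eval p (node k us # \<rho>) (caseE es) v \<longleftrightarrow> eval p (node k us # \<rho>) (es ! k) v"
  unfolding caseE_def by (rule eval_selectE) (auto simp: node_def)

subsection \<open>The program\<close>

abbreviation (input) "eq_ix \<equiv> 0 :: nat"
abbreviation (input) "add_ix \<equiv> Suc 0"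
abbreviation (input) "le_ix \<equiv> 2 :: nat"
abbreviation (input) "ctx_len_ix \<equiv> 3 :: nat"
abbreviation (input) "movable_ix \<equiv> 4 :: nat"
abbreviation (input) "lolliRs_ix \<equiv> 5 :: nat"
abbreviation (input) "push_ix \<equiv> 6 :: nat"
abbreviation (input) "pass_ix \<equiv> 7 :: nat"
abbreviation (input) "il_ix \<equiv> 8 :: nat"
abbreviation (input) "tensL_ix \<equiv> 9 :: nat"
abbreviation (input) "lolliL_ix \<equiv> 10 :: nat"
abbreviation (input) "ax_ix \<equiv> 11 :: nat"
abbreviation (input) "focus_ix \<equiv> 12 :: nat"

abbreviation (input) "trueE \<equiv> ConsE NilE NilE"

text \<open>\<open>CdrE\<close> alone would be stuck at zero; the test gives the truncating
  predecessor used in \<open>ctx_len\<close>.\<close>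

definition predE :: "expr \<Rightarrow> expr" where
  "predE e = IfE e (CdrE e) NilE"

text \<open>\<open>EqE\<close> compares atomic values only, so equality of trees needs
  recursion.\<close>

definition eq_body :: expr where
  "eq_body = IfE (AtomE (Var 0)) (IfE (AtomE (Var 1)) (EqE (Var 0) (Var 1)) NilE)
     (IfE (AtomE (Var 1)) NilE
       (IfE (Call eq_ix [CarE (Var 0), CarE (Var 1)]) (Call eq_ix [CdrE (Var 0), CdrE (Var 1)]) NilE))"

definition add_body :: expr where
  "add_body = IfE (Var 0) (ConsE NilE (Call add_ix [CdrE (Var 0), Var 1])) (Var 1)"

definition le_body :: expr where
  "le_body = IfE (Var 0) (IfE (Var 1) (Call le_ix [CdrE (Var 0), CdrE (Var 1)]) NilE) trueE"

text \<open>Here and below, the branches of \<open>caseE\<close> follow the order of the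
  constructors in the datatype.\<close>

definition ctx_len_body :: expr where
  "ctx_len_body = (let len = \<lambda>j. Call ctx_len_ix [argE j] in
     caseE [predE (len 0), len 0, len 0, predE (len 0), len 0, ConsE NilE (len 0), len 0,
       NilE, NilE, Call add_ix [len 0, len 1], Call add_ix [len 0, len 1]])"

definition movable_body :: expr where
  "movable_body = caseE [NilE, NilE, NilE, NilE, NilE,
     Call le_ix [Var 1, Call ctx_len_ix [argE 0]], Call movable_ix [argE 0, Var 1],
     NilE, NilE, NilE, Call le_ix [Var 1, Call ctx_len_ix [argE 1]]]"

definition lolliRs_body :: expr where
  "lolliRs_body = IfE (Var 0) (nodeE 0 [Call lolliRs_ix [CdrE (Var 0), Var 1]]) (Var 1)"

text \<open>In the \<open>P2LI\<close> branch, \<open>Var 0\<close> is the whole argument, which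
  \<open>nodeE 1\<close> wraps as \<open>LI2RI (P2LI f)\<close>.\<close>

definition push_body :: expr where
  "push_body = (let push = \<lambda>j. Call push_ix [argE j, Var 1, Var 2] in
     caseE [Call push_ix [argE 0, ConsE NilE (Var 1), Var 2],
       nodeE 1 [push 0], nodeE 2 [push 0], nodeE 3 [push 0],
       IfE (Call movable_ix [argE 0, Var 1]) (nodeE 4 [push 0])
         (nodeE 4 [nodeE 6 [nodeE 9 [Call lolliRs_ix [Var 1, nodeE 1 [Var 0]], Var 2]]]),
       nodeE 5 [push 0], nodeE 6 [push 0], Var 0, Var 0, Var 0, nodeE 10 [argE 0, push 1]])"

text \<open>\<open>i\<close> is the index of the function itself, \<open>es\<close> are the
  parameters handed on to the recursive call, and \<open>e\<close> computes the result of
  \<open>k\<close>.\<close>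

definition under_body :: "nat \<Rightarrow> expr list \<Rightarrow> expr \<Rightarrow> expr" where
  "under_body i es e = caseE ([nodeE 0 [Call i (argE 0 # es)], nodeE 1 [e]] @ replicate 9 (Var 0))"

definition ax_body :: expr where
  "ax_body = (let ax = \<lambda>j. Call ax_ix [argE j] in
     caseE [nodeE 1 [nodeE 4 [nodeE 6 [nodeE 7 [argE 0]]]],
       Call il_ix [nodeE 1 [nodeE 4 [nodeE 6 [nodeE 8 []]]]],
       Call tensL_ix [Call push_ix [ax 0, NilE, Call pass_ix [ax 1]]],
       nodeE 0 [Call lolliL_ix [ax 1, Call pass_ix [ax 0]]]])"

definition focus_body :: expr where
  "focus_body = (let foc = \<lambda>j. Call focus_ix [argE j] in
     caseE [Call ax_ix [argE 0], Call pass_ix [foc 0], Call lolliL_ix [foc 1, foc 0],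
       nodeE 0 [foc 0], Call il_ix [foc 0], Call tensL_ix [foc 0],
       nodeE 1 [nodeE 4 [nodeE 6 [nodeE 8 []]]], Call push_ix [foc 0, NilE, foc 1]])"

text \<open>Each function recurses over its first argument; so \<open>lolliL_RI f g\<close> takes \<open>g\<close> first.\<close>

definition program :: "expr list" where
  "program = [eq_body, add_body, le_body, ctx_len_body, movable_body, lolliRs_body, push_body,
     under_body pass_ix [] (nodeE 4 [nodeE 5 [argE 0]]),
     under_body il_ix [] (nodeE 2 [argE 0]),
     under_body tensL_ix [] (nodeE 3 [argE 0]),
     under_body lolliL_ix [Var 1] (nodeE 4 [nodeE 6 [nodeE 10 [Var 1, argE 0]]]),
     ax_body, focus_body]"

text \<open>Unfolds one call; recursive calls keep the form \<open>returns\<close> and are left to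
  the induction hypotheses.\<close>

lemma returns_program:
  "i < length program \<Longrightarrow> returns program i us v \<longleftrightarrow> eval program us (program ! i) v"
  by (simp add: returns_def)

lemma program_nth:
  "length program = 13"
  "program ! 0 = eq_body" "program ! Suc 0 = add_body" "program ! 2 = le_body"
  "program ! 3 = ctx_len_body" "program ! 4 = movable_body" "program ! 5 = lolliRs_body"
  "program ! 6 = push_body"
  "program ! 7 = under_body pass_ix [] (nodeE 4 [nodeE 5 [argE 0]])"
  "program ! 8 = under_body il_ix [] (nodeE 2 [argE 0])"
  "program ! 9 = under_body tensL_ix [] (nodeE 3 [argE 0])"
  "program ! 10 = under_body lolliL_ix [Var 1] (nodeE 4 [nodeE 6 [nodeE 10 [Var 1, argE 0]]])"
  "program ! 11 = ax_body" "program ! 12 = focus_body"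
  by (simp_all add: program_def)

section \<open>Correctness of the functions of the program\<close>

lemma eq_correct [simp]: "returns program eq_ix [u, v] w \<longleftrightarrow> w = enc_bool (u = v)"
proof (induction u arbitrary: v w)
  case (SCons u1 u2)
  then show ?case
    by (cases v) (auto simp: returns_program[of eq_ix] program_nth eq_body_def)
next
  case SNil
  show ?case by (cases v) (auto simp: returns_program program_nth eq_body_def)
next
  case (Sym a)
  show ?case by (cases v) (auto simp: returns_program program_nth eq_body_def)
qed

lemma add_correct [simp]: "returns program add_ix [num m, num n] v \<longleftrightarrow> v = num (m + n)"
proof (induction m arbitrary: v)
  case 0
  show ?case by (subst returns_program) (simp_all add: program_nth add_body_def)
next
  case (Suc m)
  then show ?case by (subst returns_program) (simp_all add: program_nth add_body_def)
qed

lemma le_correct [simp]: "returns program le_ix [num m, num n] v \<longleftrightarrow> v = enc_bool (m \<le> n)"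
proof (induction m arbitrary: n v)
  case 0
  show ?case by (subst returns_program) (simp_all add: program_nth le_body_def)
next
  case (Suc m)
  then show ?case by (subst returns_program) (cases n; simp add: program_nth le_body_def)+
qed

lemma eval_predE:
  "(\<And>v. eval p \<rho> e v \<longleftrightarrow> v = num n) \<Longrightarrow> eval p \<rho> (predE e) v \<longleftrightarrow> v = num (n - 1)"
  by (cases n) (auto simp: predE_def)

lemma ctx_len_correct [simp]:
  "returns program ctx_len_ix [enc_fderiv f] v \<longleftrightarrow> v = num (ctx_len f)"
  by (induction f arbitrary: v; subst returns_program)
    (simp_all add: program_nth ctx_len_body_def eval_predE)

lemma movable_correct [simp]:
  "returns program movable_ix [enc_fderiv f, num n] v \<longleftrightarrow> v = enc_bool (movable f n)"
  by (induction f arbitrary: v; subst returns_program) (simp_all add: program_nth movable_body_def)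

lemma lolliRs_correct [simp]:
  "returns program lolliRs_ix [num n, enc_fderiv f] v \<longleftrightarrow> v = enc_fderiv (lolliRs n f)"
  by (induction n arbitrary: v; subst returns_program) (simp_all add: program_nth lolliRs_body_def)

lemma push_correct [simp]:
  "returns program push_ix [enc_fderiv f, num n, enc_fderiv g] v \<longleftrightarrow> v = enc_fderiv (push f n g)"
proof (induction f arbitrary: n v)
  case (FLolliR f)
  from FLolliR[of "Suc n"] show ?case
    by (subst returns_program) (simp_all add: program_nth push_body_def)
next
  case (P2LI f)
  \<comment> \<open>The code of \<open>LI2RI (P2LI f)\<close> appears expanded into nodes, so
    \<open>lolliRs_correct\<close> is restated for it.\<close>
  have "returns program lolliRs_ix [num n, node (Suc 0) [node 4 [enc_fderiv f]]] v \<longleftrightarrow>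
      v = enc_fderiv (lolliRs n (LI2RI (P2LI f)))" for v
    using lolliRs_correct[of n "LI2RI (P2LI f)" v] by simp
  with P2LI show ?case
    by (subst returns_program) (simp_all add: program_nth push_body_def)
qed (subst returns_program; simp add: program_nth push_body_def)+

text \<open>Shared by the four left rules: the third assumption says that the parameters pass
  unchanged into the recursive call, the fourth that \<open>e\<close> computes
  \<open>k\<close>.\<close>

lemma under_correct:
  assumes "i < length program" "program ! i = under_body i es e"
    and "\<And>k u \<rho> vs. evals program (node k [u] # us) es vs \<longleftrightarrow> vs = us"
    and "\<And>f v. eval program (node 1 [enc_fderiv f] # us) e v \<longleftrightarrow> v = enc_fderiv (k f)"
  shows "returns program i (enc_fderiv f # us) v \<longleftrightarrow> v = enc_fderiv (under k f)"
  using assms(3,4)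
  by (induction f arbitrary: v; subst returns_program[OF assms(1)])
    (simp_all add: under_body_def assms(2) numeral_eq_Suc)

lemma pass_correct [simp]:
  "returns program pass_ix [enc_fderiv f] v \<longleftrightarrow> v = enc_fderiv (pass_RI f)"
  unfolding pass_RI_def by (rule under_correct[OF _ program_nth(9)]) (simp_all add: program_nth(1))

lemma il_correct [simp]:
  "returns program il_ix [enc_fderiv f] v \<longleftrightarrow> v = enc_fderiv (il_RI f)"
  unfolding il_RI_def by (rule under_correct[OF _ program_nth(10)]) (simp_all add: program_nth(1))

lemma tensL_correct [simp]:
  "returns program tensL_ix [enc_fderiv f] v \<longleftrightarrow> v = enc_fderiv (tensL_RI f)"
  unfolding tensL_RI_def by (rule under_correct[OF _ program_nth(11)]) (simp_all add: program_nth(1))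

lemma lolliL_correct [simp]:
  "returns program lolliL_ix [enc_fderiv g, enc_fderiv f] v \<longleftrightarrow> v = enc_fderiv (lolliL_RI f g)"
  unfolding lolliL_RI_def by (rule under_correct[OF _ program_nth(12)]) (simp_all add: program_nth(1))

text \<open>\<open>SNil\<close> is the numeral zero: no formula has been discharged.\<close>

lemma tensR_correct [simp]:
  "returns program push_ix [enc_fderiv f, SNil, enc_fderiv g] v \<longleftrightarrow> v = enc_fderiv (tensR_RI f g)"
  using push_correct[of f 0 g v] by (simp add: tensR_RI_def)

lemma ax_correct [simp]: "returns program ax_ix [enc_fma A] v \<longleftrightarrow> v = enc_fderiv (ax_RI A)"
proof (induction A arbitrary: v)
  case Unit
  show ?case
    using il_correct[of "LI2RI (P2LI (F2P FIR))"]
    by (subst returns_program) (simp_all add: program_nth ax_body_def)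
qed (subst returns_program; simp add: program_nth ax_body_def)+

lemma focus_computed [simp]:
  "returns program focus_ix [enc_deriv f] v \<longleftrightarrow> v = enc_fderiv (focus f)"
  by (induction f arbitrary: v; subst returns_program) (simp_all add: program_nth focus_body_def)

theorem mainTheorem5:
  shows
    "(\<exists>focus :: 'a deriv \<Rightarrow> 'a fderiv.
        computable_on enc_deriv enc_fderiv {f. \<exists>S \<Gamma> A. derives S \<Gamma> A f} focus \<and>
        (\<forall>S \<Gamma> A f. derives S \<Gamma> A f \<longrightarrow> fderives RI_ph Blank S (plain \<Gamma>) A (focus f)) \<and>
        (\<forall>A B f g. derives (Some A) [] B f \<longrightarrow> derives (Some A) [] B g \<longrightarrow>
           (ceq (Some A) [] B f g \<longleftrightarrow> focus f = focus g))) \<and>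
     decidable_on (enc_pair enc_fderiv enc_fderiv)
       {(d, d'). \<exists>ph x S \<Gamma> C. fderives ph x S \<Gamma> C d \<and> fderives ph x S \<Gamma> C (d' :: 'a fderiv)}
       (\<lambda>(d, d'). d = d') \<and>
     (\<exists>p e. \<forall>(A :: 'a fma) B. \<forall>\<phi> \<in> FSkMCl_hom A B. \<forall>\<psi> \<in> FSkMCl_hom A B. \<forall>f \<in> \<phi>. \<forall>g \<in> \<psi>.
        eval p [enc_problem ((A, B), (f, g))] e (enc_bool (\<phi> = \<psi>)))"
proof (intro conjI)
  show "\<exists>focus :: 'a deriv \<Rightarrow> 'a fderiv.
      computable_on enc_deriv enc_fderiv {f. \<exists>S \<Gamma> A. derives S \<Gamma> A f} focus \<and>
      (\<forall>S \<Gamma> A f. derives S \<Gamma> A f \<longrightarrow> fderives RI_ph Blank S (plain \<Gamma>) A (focus f)) \<and>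
      (\<forall>A B f g. derives (Some A) [] B f \<longrightarrow> derives (Some A) [] B g \<longrightarrow>
         (ceq (Some A) [] B f g \<longleftrightarrow> focus f = focus g))"
  proof (intro exI[of _ focus] conjI)
    show "computable_on enc_deriv enc_fderiv {f. \<exists>S \<Gamma> A. derives S \<Gamma> A f} focus"
      unfolding computable_on_def
      by (intro exI[of _ program] exI[of _ "Call focus_ix [Var 0]"]) simp
  qed (use focus_correct focus_eq_iff in blast)+
  show "decidable_on (enc_pair enc_fderiv enc_fderiv)
      {(d, d'). \<exists>ph x S \<Gamma> C. fderives ph x S \<Gamma> C d \<and> fderives ph x S \<Gamma> C (d' :: 'a fderiv)}
      (\<lambda>(d, d'). d = d')"
    unfolding decidable_on_def computable_on_def
    by (intro exI[of _ program] exI[of _ "Call eq_ix [CarE (Var 0), CdrE (Var 0)]"])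
      (auto simp: enc_pair_def)
  show "\<exists>p e. \<forall>(A :: 'a fma) B. \<forall>\<phi> \<in> FSkMCl_hom A B. \<forall>\<psi> \<in> FSkMCl_hom A B. \<forall>f \<in> \<phi>. \<forall>g \<in> \<psi>.
      eval p [enc_problem ((A, B), (f, g))] e (enc_bool (\<phi> = \<psi>))"
    \<comment> \<open>The outer \<open>CdrE\<close> step reaches the pair \<open>(f, g)\<close> in
      the coded problem; comparing the two focused forms decides equality of the classes by
      \<open>FSkMCl_hom_eq_iff\<close>.\<close>
    by (intro exI[of _ program] exI[of _ "Call eq_ix [Call focus_ix [CarE (CdrE (Var 0))],
        Call focus_ix [CdrE (CdrE (Var 0))]]"])
      (auto simp: enc_problem_def enc_pair_def FSkMCl_hom_eq_iff)
qed

end
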